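(* Let $G=(V,E)$ be a connected graph, $K\subseteq V$ a set of $k$ terminals, $\Sigma$ a finite alphabet, $h$ a nonnegative function, and let $f:\Sigma^K\to\{0,1\}$ be $h$-maximally hard on the star graph. Then \[R(f,G,K,\Sigma)\ge\Omega\left(\frac{\mathrm{ST}(G,K)\cdot h(|\Sigma|)}{\log^2k}\right).\]
   Context: Communication model: a processor at every node of $G$; each terminal $v\in K$ holds $X^v\in\Sigma$. Nodes communicate in rounds by sending bits to neighbours along edges (private channels); behaviour depends on own input, a public random string and received messages; if one endpoint of an edge expects a message, the other must send one. A pre-designated node outputs $f$. $R(f,G,K,\Sigma)$ is the minimum over public-coin randomized protocols correct with probability $\ge2/3$ on every input of the worst-case expected total number of bits sent over all edges. $\mathrm{ST}(G,K)$ is the minimum number of edges of a subtree of $G$ containing $K$. A multicut $C$ of $K$ is a collection of nonempty pairwise disjoint subsets $C_1,\dots,C_r$ of $K$ (explicit sets), $|C|=r$; its implicit set is $K\setminus\bigcup_jC_j$ (possibly empty). $f$ is $h$-maximally hard on the star graph if there is an absolute constant $c>0$ such that for every multicut $C$ of $K$ there is a distribution $\mu^f_C$ on $\Sigma^K$ with the property: on the star graph with $r$ leaves, where leaf $j$ holds the inputs of all terminals in $C_j$ and the center holds the inputs of the implicit set, every protocol computing $f$ correctly (error $\le1/3$ on every input) has expected cost under $\mu^f_C$ at least $c\,|C|\,h(|\Sigma|)$. $\Omega$ hides constants. *)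

theory Defs
  imports
    "HOL-Probability.Probability_Mass_Function"
    "Graph_Theory.Digraph_Component"
    "Graph_Theory.Pair_Digraph"
begin

section \<open>Steiner trees\<close>

text \<open>
  Finite simple graphs are symmetric loop-free digraphs (\<^locale>\<open>pair_graph\<close>), so every
  edge is a pair of opposite arcs.  The predicate \<^const>\<open>tree\<close> of the graph library is not
  usable here: it only forbids directed cycles, and it counts \<open>a, b, a\<close> as a cycle.
  In a loop-free symmetric digraph the cycles of length at least 3 are exactly the cycles of the
  undirected graph.
\<close>

definition subtree :: "'v pair_pre_digraph \<Rightarrow> 'v pair_pre_digraph \<Rightarrow> bool" where
  "subtree T G \<longleftrightarrow>
     pair_graph T \<and> subgraph (with_proj T) (with_proj G) \<and>
     Digraph_Component.connected (with_proj T) \<and>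
     \<not> (\<exists>p. pre_digraph.cycle (with_proj T) p \<and> 3 \<le> length p)"

definition steiner_cost :: "'v pair_pre_digraph \<Rightarrow> 'v set \<Rightarrow> nat" where
  "steiner_cost G K = Inf {card (parcs T) div 2 | T. subtree T G \<and> K \<subseteq> pverts T}"


section \<open>Protocols\<close>

text \<open>
  An input is a function \<open>X \<in> K \<rightarrow>\<^sub>E Sig\<close>; a network is a graph \<open>N\<close> together with
  a map \<open>I\<close> saying which input coordinates \<open>I v \<subseteq> K\<close> the node \<open>v\<close> holds.  (In the
  graph \<open>G\<close> a terminal holds its own coordinate; in the star a node holds those of several
  terminals.)

  The record describes the behaviour for one fixed value of the public random string.  The local
  view of a node before a round consists of the part of the input it holds and of the list, over
  the earlier rounds, of the messages it received from each node.  In every round \<open>u\<close> sends the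
  bit string \<open>message u v\<close>, computed from its view, to each neighbour \<open>v\<close>; the empty
  string means that nothing is sent.  The number of bits that \<open>v\<close> waits for from \<open>u\<close> is
  \<open>expects v u\<close>, computed from the view of \<open>v\<close>.

  As inputs are finitely many, the number of rounds may be taken to depend on the public random
  string only: idle rounds cost nothing.
\<close>

type_synonym ('n, 'k, 's) view = "('k \<Rightarrow> 's) \<times> ('n \<Rightarrow> bool list) list"

record ('n, 'k, 's) protocol =
  rounds :: nat
  message :: "'n \<Rightarrow> 'n \<Rightarrow> ('n, 'k, 's) view \<Rightarrow> bool list"
  expects :: "'n \<Rightarrow> 'n \<Rightarrow> ('n, 'k, 's) view \<Rightarrow> nat"
  answer :: "'n \<Rightarrow> ('n, 'k, 's) view \<Rightarrow> bool"

primrec view :: "'n pair_pre_digraph \<Rightarrow> ('n \<Rightarrow> 'k set) \<Rightarrow> ('n, 'k, 's) protocol \<Rightarrow>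
    ('k \<Rightarrow> 's) \<Rightarrow> nat \<Rightarrow> 'n \<Rightarrow> ('n, 'k, 's) view" where
  "view N I \<pi> X 0 v = (restrict X (I v), [])"
| "view N I \<pi> X (Suc t) v =
     (restrict X (I v),
      snd (view N I \<pi> X t v) @
        [\<lambda>u. if (u, v) \<in> parcs N then message \<pi> u v (view N I \<pi> X t u) else []])"

text \<open>
  If one endpoint of an edge expects a message, the other one sends it, and conversely: sender and
  receiver agree on the number of bits in every round of every execution.  Thus silence carries no
  information, and sending \<open>n\<close> bits in a round is the same as sending \<open>n\<close> single bits in
  consecutive rounds.
\<close>

definition legal :: "'n pair_pre_digraph \<Rightarrow> ('n \<Rightarrow> 'k set) \<Rightarrow> 'k set \<Rightarrow> 's set \<Rightarrow>
    ('n, 'k, 's) protocol \<Rightarrow> bool" where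
  "legal N I K Sig \<pi> \<longleftrightarrow>
     (\<forall>X \<in> K \<rightarrow>\<^sub>E Sig. \<forall>t < rounds \<pi>. \<forall>(u, v) \<in> parcs N.
        length (message \<pi> u v (view N I \<pi> X t u)) = expects \<pi> v u (view N I \<pi> X t v))"

definition cost :: "'n pair_pre_digraph \<Rightarrow> ('n \<Rightarrow> 'k set) \<Rightarrow> ('n, 'k, 's) protocol \<Rightarrow>
    ('k \<Rightarrow> 's) \<Rightarrow> nat" where
  "cost N I \<pi> X =
     (\<Sum>t < rounds \<pi>. \<Sum>(u, v) \<in> parcs N. length (message \<pi> u v (view N I \<pi> X t u)))"

text \<open>
  A public-coin protocol is a distribution \<open>P\<close> on deterministic protocols.  Discrete
  distributions suffice, since on a finite network with finitely many inputs there are only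
  countably many behaviours.  The node \<open>w\<close> giving the output is fixed in advance, i.e.
  independent of the coins.
\<close>

definition computes :: "'n pair_pre_digraph \<Rightarrow> ('n \<Rightarrow> 'k set) \<Rightarrow> 'k set \<Rightarrow> 's set \<Rightarrow>
    (('k \<Rightarrow> 's) \<Rightarrow> bool) \<Rightarrow> 'n \<Rightarrow> ('n, 'k, 's) protocol pmf \<Rightarrow> bool" where
  "computes N I K Sig f w P \<longleftrightarrow>
     w \<in> pverts N \<and> (\<forall>\<pi> \<in> set_pmf P. legal N I K Sig \<pi>) \<and>
     (\<forall>X \<in> K \<rightarrow>\<^sub>E Sig.
        measure_pmf.prob P {\<pi>. answer \<pi> w (view N I \<pi> X (rounds \<pi>) w) = f X} \<ge> 2 / 3)"

definition expected_cost :: "'n pair_pre_digraph \<Rightarrow> ('n \<Rightarrow> 'k set) \<Rightarrow>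
    ('n, 'k, 's) protocol pmf \<Rightarrow> ('k \<Rightarrow> 's) \<Rightarrow> ennreal" where
  "expected_cost N I P X = (\<integral>\<^sup>+ \<pi>. of_nat (cost N I \<pi> X) \<partial>measure_pmf P)"

definition terminal_input :: "'v set \<Rightarrow> 'v \<Rightarrow> 'v set" where
  "terminal_input K v = K \<inter> {v}"

text \<open>\<open>R(f, G, K, Sig)\<close>; the choice of the output node is part of the protocol.\<close>

definition rand_cc :: "(('v \<Rightarrow> 's) \<Rightarrow> bool) \<Rightarrow> 'v pair_pre_digraph \<Rightarrow> 'v set \<Rightarrow> 's set \<Rightarrow>
    ennreal" where
  "rand_cc f G K Sig =
     Inf {(SUP X \<in> K \<rightarrow>\<^sub>E Sig. expected_cost G (terminal_input K) P X) | w P.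
            computes G (terminal_input K) K Sig f w P}"


section \<open>Maximal hardness on the star\<close>

definition multicut :: "'v set \<Rightarrow> 'v set set \<Rightarrow> bool" where
  "multicut K C \<longleftrightarrow> (\<forall>A \<in> C. A \<noteq> {} \<and> A \<subseteq> K) \<and> disjoint C"

text \<open>The center is \<^const>\<open>None\<close>, the leaf of the explicit set \<open>A\<close> is \<open>Some A\<close>.\<close>

definition star :: "'v set set \<Rightarrow> 'v set option pair_pre_digraph" where
  "star C = \<lparr> pverts = insert None (Some ` C),
              parcs = (\<lambda>A. (None, Some A)) ` C \<union> (\<lambda>A. (Some A, None)) ` C \<rparr>"

definition star_input :: "'v set \<Rightarrow> 'v set set \<Rightarrow> 'v set option \<Rightarrow> 'v set" where
  "star_input K C x = (case x of None \<Rightarrow> K - \<Union>C | Some A \<Rightarrow> A)"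

text \<open>
  The multicut \<open>{K}\<close> (one leaf holding the whole input) is left out: that leaf can output
  \<open>f\<close> without any communication, so that including it would force \<open>h (card Sig) = 0\<close>.
  Here \<open>c\<close> is the absolute constant of the definition.
\<close>

definition maximally_hard :: "real \<Rightarrow> (nat \<Rightarrow> real) \<Rightarrow> 'v set \<Rightarrow> 's set \<Rightarrow>
    (('v \<Rightarrow> 's) \<Rightarrow> bool) \<Rightarrow> bool" where
  "maximally_hard c h K Sig f \<longleftrightarrow>
     (\<forall>C. multicut K C \<and> C \<noteq> {K} \<longrightarrow>
        (\<exists>\<mu> :: ('v \<Rightarrow> 's) pmf. set_pmf \<mu> \<subseteq> K \<rightarrow>\<^sub>E Sig \<and>
           (\<forall>w P. computes (star C) (star_input K C) K Sig f w P \<longrightarrow>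
              ennreal (c * real (card C) * h (card Sig)) \<le>
                (\<integral>\<^sup>+ X. expected_cost (star C) (star_input K C) P X \<partial>measure_pmf \<mu>))))"

end

theory Submission
  imports Defs "HOL-Analysis.Harmonic_Numbers"
begin

text \<open>
  Let \<open>C\<close> be a partition of \<open>K\<close> whose classes have pairwise disjoint neighbourhoods of every radius
  below \<open>N\<close>.  For each such radius \<open>r\<close>, a protocol on \<open>G\<close> becomes a protocol on the star of \<open>C\<close>: a
  leaf plays the nodes at distance at most \<open>r\<close> from its class and the center plays all other nodes
  and relays between the leaves.  An arc of \<open>G\<close> leaves a neighbourhood for only one pair of
  a radius and a class, so each message of \<open>G\<close> is paid for at most twice over all radii.  As all these
  star protocols face the same hard distribution, the expected cost on \<open>G\<close> is at least
  \<open>c * N * card C * h (card Sig) / 2\<close>.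

  Now run Kruskal's algorithm on the terminals.  When \<open>n\<close> clusters are left, the next two are
  joined by at most \<open>2 * N\<close> edges, where \<open>N\<close> is the least radius at which two clusters meet.  By the
  above, \<open>N\<close> is at most \<open>1 / n\<close> times twice the cost of the protocol divided by
  \<open>c * h (card Sig)\<close>.  Summing over \<open>n\<close> gives a harmonic sum, hence a Steiner tree whose size is
  bounded with a single factor \<open>ln (card K)\<close>.
\<close>

section \<open>Steiner trees from connected edge sets\<close>

lemma mk_symmetric_with_proj:
  assumes "pair_sym_digraph T"
  shows "mk_symmetric (with_proj T) = T"
proof -
  interpret pair_sym_digraph T by fact
  show ?thesis using arcs_symmetric by (cases T) (auto simp: mk_symmetric_def)
qed

lemma connected_with_projI:
  assumes "pair_sym_digraph T" and "a \<in> pverts T"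
    and reach: "\<And>v. v \<in> pverts T \<Longrightarrow> (a, v) \<in> (parcs T)\<^sup>*"
  shows "Digraph_Component.connected (with_proj T)"
proof -
  interpret pair_sym_digraph T by fact
  have conv: "a \<rightarrow>\<^sup>*\<^bsub>with_proj T\<^esub> v" if "v \<in> pverts T" for v
    using reach[OF that] \<open>a \<in> pverts T\<close>
    by (metis reachable_neq_reachable1 reachable1_reachable reachable_refl rtranclD)
  show ?thesis
    unfolding Digraph_Component.connected_def mk_symmetric_with_proj[OF assms(1)]
      strongly_connected_def with_proj_simps
    using conv \<open>a \<in> pverts T\<close> symmetric_reachable'[OF conv] reachable_trans by blast
qed

lemma connected_with_projD:
  assumes "pair_sym_digraph T" and "Digraph_Component.connected (with_proj T)"
    and "a \<in> pverts T" "b \<in> pverts T"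
  shows "(a, b) \<in> (parcs T)\<^sup>*"
proof -
  interpret pair_sym_digraph T by fact
  show ?thesis
    using assms reachable_rtranclI[of T a b]
    unfolding Digraph_Component.connected_def mk_symmetric_with_proj[OF assms(1)]
      strongly_connected_def with_proj_simps by auto
qed

lemma pcas_rtrancl:
  "pcas u p v \<Longrightarrow> (u, v) \<in> (set p)\<^sup>*"
proof (induction u p v rule: pcas.induct)
  case (2 u e es v)
  then have "(snd e, v) \<in> (set (e # es))\<^sup>*"
    using rtrancl_mono[of "set es" "set (e # es)"] by auto
  moreover have "(u, snd e) \<in> set (e # es)" using 2 by (cases e) auto
  ultimately show ?case by (meson converse_rtrancl_into_rtrancl)
qed auto

text \<open>A cycle visits its vertices once, so after its first arc \<open>(a, b)\<close> the
  remaining walk from \<open>b\<close> back to \<open>a\<close> uses neither that arc nor its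
  reverse. Hence the edge can be removed without losing a connection.\<close>

lemma long_cycle_bypass:
  assumes cyc: "pre_digraph.cycle (with_proj T) p" and len: "3 \<le> length p" and "pair_wf_digraph T"
  obtains a b where "(a, b) \<in> parcs T" "(b, a) \<in> (parcs T - {(a, b), (b, a)})\<^sup>*"
proof -
  interpret pair_wf_digraph T by fact
  from cyc obtain a where a: "awalk a p a" "distinct (tl (pawalk_verts a p))" "p \<noteq> []"
    by (auto simp: cycle_def)
  then obtain e q where p: "p = e # q" by (cases p) auto
  from a obtain b where e: "e = (a, b)" by (cases e) (auto simp: p awalk_def)
  from len p obtain e' r where q: "q = e' # r" and r: "r \<noteq> []"
    by (cases q) (auto simp: Suc_le_eq)
  from a obtain b' where e': "e' = (b, b')" by (cases e') (auto simp: p q e awalk_def)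
  have cas: "pcas b q a" and sub: "set p \<subseteq> parcs T" using a by (auto simp: p e awalk_def)
  have d: "distinct (pawalk_verts b q)" using a by (auto simp: p e)
  have last: "last (pawalk_verts b' r) = a"
    using a r by (auto simp: p q e e' awalk_def) (metis awlast_if_cas)
  have d': "b \<notin> set (pawalk_verts b' r)" "distinct (pawalk_verts b' r)" using d by (auto simp: q e')
  have aset: "a \<in> set (pawalk_verts b' r)" using last by (metis awalk_verts_non_Nil last_in_set)
  have ab: "a \<noteq> b" using d' aset by auto
  \<comment> \<open>Length at least 3 enters here: \<open>r\<close> is a nonempty walk from
    \<open>b'\<close> to \<open>a\<close> with distinct vertices, so its ends differ.\<close>
  have b'a: "b' \<noteq> a"
  proof
    assume "b' = a"
    obtain f r' where rr: "r = f # r'" using r by (cases r) auto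
    have "fst f = b'" using a by (auto simp: p q e e' rr awalk_def)
    then show False using d' last \<open>b' = a\<close> 
      by (auto simp: rr split: if_splits) (metis awalk_verts_non_Nil last_in_set)
  qed
  have tails: "fst ` set r \<subseteq> set (pawalk_verts b' r)"
    by (induction r arbitrary: b') auto
  have "set q \<subseteq> parcs T - {(a, b), (b, a)}"
  proof -
    have "(a, b) \<notin> set q"
    proof
      assume "(a, b) \<in> set q"
      then have "(a, b) \<in> set r" using ab by (auto simp: q e')
      moreover have "pcas b' r a" using cas by (simp add: q e')
      ultimately have "b \<in> set (pawalk_verts b' r)"
        using r by (force simp: awalk_verts_conv')
      then show False using d' by blast
    qed
    \<comment> \<open>The arc \<open>(b, a)\<close> could only be the first arc
      \<open>(b, b')\<close> of \<open>q\<close>, as no later arc starts at \<open>b\<close>; but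
      \<open>b'\<close> is not \<open>a\<close>.\<close>
    moreover have "(b, a) \<notin> set q" using tails d' b'a by (force simp: q e')
    ultimately show ?thesis using sub by (auto simp: p)
  qed
  then have "(b, a) \<in> (parcs T - {(a, b), (b, a)})\<^sup>*"
    using pcas_rtrancl[OF cas] rtrancl_mono by blast
  moreover have "(a, b) \<in> parcs T" using sub by (auto simp: p e)
  ultimately show ?thesis using that by blast
qed

text \<open>A smallest symmetric subset of \<open>F\<close> that still joins \<open>a\<close> to
  \<open>K\<close> has no long cycle in the component of \<open>a\<close>, since an edge of such a
  cycle could be dropped. Halving converts arcs to edges.\<close>

lemma steiner_cost_le:
  assumes G: "pair_graph G" and F: "F \<subseteq> parcs G" "sym F"
    and a: "a \<in> pverts G" and K: "\<And>v. v \<in> K \<Longrightarrow> (a, v) \<in> F\<^sup>*"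
  shows "steiner_cost G K \<le> card F div 2"
proof -
  interpret G: pair_graph G by fact
  define good where "good E \<longleftrightarrow> E \<subseteq> F \<and> sym E \<and> (\<forall>v\<in>K. (a, v) \<in> E\<^sup>*)" for E
  have "good F" using F K by (auto simp: good_def)
  then obtain E0 where E0: "good E0" and E0min: "\<And>E'. good E' \<Longrightarrow> card E0 \<le> card E'"
    using ex_has_least_nat[of good F card] by blast
  define V where "V = {v. (a, v) \<in> E0\<^sup>*}"
  define T where "T = \<lparr>pverts = V, parcs = E0 \<inter> V \<times> V\<rparr>"
  have EG: "E0 \<subseteq> parcs G" using E0 F by (auto simp: good_def)
  have finE: "finite E0" using EG by (rule finite_subset) (rule G.pair_finite_arcs)
  have VG: "V \<subseteq> pverts G"
  proof
    fix v assume "v \<in> V"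
    then have "(a, v) \<in> E0\<^sup>*" by (simp add: V_def)
    then show "v \<in> pverts G"
      using EG a by (cases rule: rtrancl.cases) (auto dest: G.in_arcsD2)
  qed
  have symE: "sym E0" using E0 by (simp add: good_def)
  have arcsT: "parcs T = {(u, v) \<in> E0. u \<in> V}"
    by (auto simp: T_def V_def)
  have pgT: "pair_graph T"
  proof
    show "fst e \<in> pverts T" "snd e \<in> pverts T" if "e \<in> parcs T" for e
      using that by (auto simp: T_def)
    show "finite (pverts T)" using finite_subset[OF VG G.pair_finite_verts] by (simp add: T_def)
    show "finite (parcs T)" using finE by (auto simp: T_def)
    show "fst e \<noteq> snd e" if "e \<in> parcs T" for e
      using that EG by (auto simp: T_def dest!: G.no_loops')
    show "symmetric T" using symE by (auto simp: T_def symmetric_def sym_def)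
  qed
  then interpret T: pair_graph T .
  have reachT: "(a, v) \<in> (parcs T)\<^sup>*" if "(a, v) \<in> E0\<^sup>*" for v
    using that
  proof (induction)
    case (step y z)
    then have "(y, z) \<in> parcs T" by (auto simp: arcsT V_def)
    with step show ?case by auto
  qed auto
  have conT: "Digraph_Component.connected (with_proj T)"
  proof (rule connected_with_projI)
    show "pair_sym_digraph T" by unfold_locales
    show "a \<in> pverts T" by (simp add: T_def V_def)
    show "(a, v) \<in> (parcs T)\<^sup>*" if "v \<in> pverts T" for v
      using that by (intro reachT) (simp add: T_def V_def)
  qed
  have noc: "\<not> (\<exists>p. pre_digraph.cycle (with_proj T) p \<and> 3 \<le> length p)"
  proof
    assume "\<exists>p. pre_digraph.cycle (with_proj T) p \<and> 3 \<le> length p"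
    then obtain x y where xy: "(x, y) \<in> parcs T" and yx: "(y, x) \<in> (parcs T - {(x, y), (y, x)})\<^sup>*"
      using long_cycle_bypass[OF _ _ T.pair_wf_digraph] by metis
    \<comment> \<open>Without this edge everything stays reachable through the bypass, against the
      minimality of \<open>E0\<close>.\<close>
    define D where "D = E0 - {(x, y), (y, x)}"
    have symD': "sym D" using symE by (auto simp: D_def sym_def)
    have "(y, x) \<in> D\<^sup>*" using yx rtrancl_mono[of "parcs T - {(x, y), (y, x)}" D] by (auto simp: D_def T_def)
    moreover then have "(x, y) \<in> D\<^sup>*" using sym_rtrancl[OF symD'] by (auto dest: symD)
    ultimately have "E0 \<subseteq> D\<^sup>*" by (auto simp: D_def)
    then have "E0\<^sup>* \<subseteq> D\<^sup>*" by (rule rtrancl_subset_rtrancl)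
    then have "good D" using E0 symD' by (auto simp: good_def D_def)
    then have "card E0 \<le> card D" by (rule E0min)
    moreover have "card D < card E0"
      using xy finE by (intro psubset_card_mono) (auto simp: D_def T_def)
    ultimately show False by simp
  qed
  have "subgraph (with_proj T) (with_proj G)"
    using VG EG G.wf_digraph_axioms T.wf_digraph_axioms
    by (auto simp: subgraph_def compatible_def T_def)
  then have "subtree T G" using pgT conT noc by (simp add: subtree_def)
  moreover have "K \<subseteq> pverts T" using E0 by (auto simp: good_def T_def V_def)
  ultimately have "steiner_cost G K \<le> card (parcs T) div 2"
    unfolding steiner_cost_def by (intro cInf_lower) auto
  also have "card (parcs T) \<le> card F"
    using E0 F G.pair_finite_arcs finite_subset[of F "parcs G"] by (intro card_mono) (auto simp: T_def good_def)
  finally show ?thesis by (simp add: div_le_mono)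
qed

section \<open>Balls around the clusters and Kruskal's algorithm\<close>

primrec nbhd :: "'v pair_pre_digraph \<Rightarrow> nat \<Rightarrow> 'v set \<Rightarrow> 'v set" where
  "nbhd G 0 A = A"
| "nbhd G (Suc r) A = nbhd G r A \<union> parcs G `` nbhd G r A"

lemma nbhd_mono: "r \<le> s \<Longrightarrow> nbhd G r A \<subseteq> nbhd G s A"
  by (rule lift_Suc_mono_le) auto

text \<open>Every step outwards costs one edge, that is two opposite arcs, whence
  \<open>2 * r\<close>. Symmetry of \<open>F\<close> lets the path be walked in either
  direction.\<close>

lemma nbhd_path:
  fixes G :: "'v pair_pre_digraph"
  assumes "sym (parcs G)" and "v \<in> nbhd G r A"
  shows "\<exists>a\<in>A. \<exists>F. F \<subseteq> parcs G \<and> sym F \<and> finite F \<and> card F \<le> 2 * r \<and> (a, v) \<in> F\<^sup>*"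
  using assms(2)
proof (induction r arbitrary: v)
  case 0
  then have "v \<in> A" by simp
  moreover have "sym ({} :: ('v \<times> 'v) set)" by (simp add: sym_def)
  ultimately show ?case by (metis card.empty empty_subsetI finite.emptyI rtrancl.rtrancl_refl zero_le)
next
  case (Suc r)
  show ?case
  proof (cases "v \<in> nbhd G r A")
    case True
    from Suc.IH[OF this] obtain a F where "a \<in> A" "F \<subseteq> parcs G" "sym F" "finite F" "card F \<le> 2 * r"
      "(a, v) \<in> F\<^sup>*" by blast
    then show ?thesis by (intro bexI[of _ a] exI[of _ F]) simp_all
  next
    case False
    then obtain u where u: "u \<in> nbhd G r A" "(u, v) \<in> parcs G" using Suc.prems by auto
    obtain a F where F: "a \<in> A" "F \<subseteq> parcs G" "sym F" "finite F" "card F \<le> 2 * r" "(a, u) \<in> F\<^sup>*"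
      using Suc.IH[OF u(1)] by (elim bexE exE conjE) (rule that)
    let ?F = "insert (u, v) (insert (v, u) F)"
    have card_insert: "card (insert e E) \<le> Suc (card E)" if "finite E" for e and E :: "('v \<times> 'v) set"
      using that by (cases "e \<in> E") (simp_all add: insert_absorb)
    have "card ?F \<le> Suc (card (insert (v, u) F))" by (rule card_insert) (use F in simp)
    also have "\<dots> \<le> Suc (Suc (card F))" using card_insert[OF F(4)] by simp
    also have "\<dots> \<le> 2 * Suc r" using F(5) by simp
    finally have "card ?F \<le> 2 * Suc r" .
    moreover have "(a, v) \<in> ?F\<^sup>*"
    proof -
      have "F\<^sup>* \<subseteq> ?F\<^sup>*" by (rule rtrancl_mono) auto
      with F(6) have "(a, u) \<in> ?F\<^sup>*" by blast
      then show ?thesis by (rule rtrancl_into_rtrancl) simp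
    qed
    moreover have "sym ?F" "?F \<subseteq> parcs G" using F(2,3) u(2) assms(1) unfolding sym_def by blast+
    ultimately show ?thesis using F by (intro bexI[of _ a] exI[of _ ?F]) simp_all
  qed
qed

lemma rtrancl_nbhd: "(a, b) \<in> (parcs G)\<^sup>* \<Longrightarrow> a \<in> A \<Longrightarrow> \<exists>r. b \<in> nbhd G r A"
proof (induction rule: rtrancl_induct)
  case base
  then show ?case by (intro exI[of _ 0]) simp
next
  case (step y z)
  then obtain r where "y \<in> nbhd G r A" by blast
  then show ?case using step by (intro exI[of _ "Suc r"]) auto
qed

text \<open>Kruskal's algorithm: the next pair of clusters to be merged is one whose neighbourhoods
  meet at the smallest radius.\<close>

lemma kruskal_clusters:
  fixes G :: "'v pair_pre_digraph" and M :: real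
  assumes G: "pair_graph G" "Digraph_Component.connected (with_proj G)" and K: "K \<subseteq> pverts G"
    and M: "\<And>C N. partition_on K C \<Longrightarrow> 2 \<le> card C \<Longrightarrow>
        (\<And>r A B. r < N \<Longrightarrow> A \<in> C \<Longrightarrow> B \<in> C \<Longrightarrow> A \<noteq> B \<Longrightarrow> nbhd G r A \<inter> nbhd G r B = {}) \<Longrightarrow>
        real N * real (card C) \<le> M"
    and n: "1 \<le> n" "n \<le> card K"
  shows "\<exists>C F. partition_on K C \<and> card C = n \<and> F \<subseteq> parcs G \<and> sym F \<and>
     (\<forall>A\<in>C. \<forall>a\<in>A. \<forall>b\<in>A. (a, b) \<in> F\<^sup>*) \<and> real (card F) \<le> 4 * M * (harm (card K) - harm n)"
  using n(2,1)
\<comment> \<open>The induction runs downwards, starting from \<open>card K\<close> singleton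
  clusters and no edges.\<close>
proof (induction rule: inc_induct)
  case base
  have "card ((\<lambda>a. {a}) ` K) = card K" by (rule card_image) (auto simp: inj_on_def)
  then show ?case
    by (intro exI[of _ "(\<lambda>a. {a}) ` K"] exI[of _ "{}"])
      (auto simp: partition_on_def disjoint_def sym_def)
next
  case (step n)
  interpret G: pair_graph G by fact
  have symG: "sym (parcs G)" using G.arcs_symmetric by (auto intro: symI)
  from step obtain C F where C: "partition_on K C" "card C = Suc n" and F: "F \<subseteq> parcs G" "sym F"
    and conn: "\<And>A a b. A \<in> C \<Longrightarrow> a \<in> A \<Longrightarrow> b \<in> A \<Longrightarrow> (a, b) \<in> F\<^sup>*"
    and cF: "real (card F) \<le> 4 * M * (harm (card K) - harm (Suc n))" by auto
  have finC: "finite C" using C(2) card.infinite by fastforce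
  define meet where
    "meet r A B \<longleftrightarrow> A \<in> C \<and> B \<in> C \<and> A \<noteq> B \<and> nbhd G r A \<inter> nbhd G r B \<noteq> {}" for r A B
  have "\<exists>r A B. meet r A B"
  proof -
    have "2 \<le> card C" using C step by simp
    then obtain A B where AB: "A \<in> C" "B \<in> C" "A \<noteq> B"
      by (metis One_nat_def card_le_Suc0_iff_eq finC not_less_eq_eq numeral_2_eq_2)
    have "A \<noteq> {}" "B \<noteq> {}" using AB C by (auto simp: partition_on_def)
    then obtain a b where ab: "a \<in> A" "b \<in> B" by blast
    then have "a \<in> pverts G" "b \<in> pverts G" using AB C K by (auto simp: partition_on_def)
    then have "(a, b) \<in> (parcs G)\<^sup>*"
      using connected_with_projD[OF G.pair_sym_digraph_axioms G(2)] by blast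
    from rtrancl_nbhd[OF this ab(1)] obtain r where "b \<in> nbhd G r A" by blast
    moreover have "b \<in> nbhd G r B" using ab nbhd_mono[of 0 r G B] by auto
    ultimately show ?thesis using AB by (auto simp: meet_def)
  qed
  then obtain r where r: "\<exists>A B. meet r A B" and rmin: "\<And>s. s < r \<Longrightarrow> \<not> (\<exists>A B. meet s A B)"
    using exists_least_iff[of "\<lambda>r. \<exists>A B. meet r A B"] by auto
  from r obtain A B x where AB: "A \<in> C" "B \<in> C" "A \<noteq> B" and x: "x \<in> nbhd G r A" "x \<in> nbhd G r B"
    by (auto simp: meet_def)
  \<comment> \<open>By minimality of \<open>r\<close> no two clusters meet at a smaller radius, so
    assumption \<open>M\<close> applies with \<open>N = r\<close>; there are \<open>Suc n\<close>
    clusters, at least two.\<close>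
  have rM: "real r * real (Suc n) \<le> M"
    using M[OF C(1), of r] rmin C(2) step by (auto simp: meet_def)
  obtain a Fa where a: "a \<in> A" and Fa: "Fa \<subseteq> parcs G" "sym Fa" "card Fa \<le> 2 * r" "(a, x) \<in> Fa\<^sup>*"
    using nbhd_path[OF symG x(1)] by blast
  obtain b Fb where b: "b \<in> B" and Fb: "Fb \<subseteq> parcs G" "sym Fb" "card Fb \<le> 2 * r" "(b, x) \<in> Fb\<^sup>*"
    using nbhd_path[OF symG x(2)] by blast
  define F' where "F' = F \<union> Fa \<union> Fb"
  have symF': "sym F'" unfolding F'_def by (intro sym_Un F Fa Fb)
  have mono: "F\<^sup>* \<subseteq> F'\<^sup>*" "Fa\<^sup>* \<subseteq> F'\<^sup>*" "Fb\<^sup>* \<subseteq> F'\<^sup>*"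
    unfolding F'_def by (rule rtrancl_mono; blast)+
  \<comment> \<open>From \<open>a\<close> the cluster \<open>B\<close> is reached through the
    meeting node \<open>x\<close>: along \<open>Fa\<close> to \<open>x\<close>, backwards along
    \<open>Fb\<close> to \<open>b\<close>, then inside \<open>B\<close>.\<close>
  have toa: "(a, y) \<in> F'\<^sup>*" if y: "y \<in> A \<union> B" for y
  proof (cases "y \<in> A")
    case True
    then show ?thesis using subsetD[OF mono(1) conn[OF AB(1) a]] by simp
  next
    case False
    then have "(b, y) \<in> F\<^sup>*" using y conn[OF AB(2) b] by simp
    then have "(b, y) \<in> F'\<^sup>*" using mono(1) by (rule rev_subsetD)
    moreover have "(b, x) \<in> F'\<^sup>*" using Fb(4) mono(3) by (rule rev_subsetD)
    then have "(x, b) \<in> F'\<^sup>*" by (rule symD[OF sym_rtrancl[OF symF']])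
    moreover have "(a, x) \<in> F'\<^sup>*" using Fa(4) mono(2) by (rule rev_subsetD)
    ultimately show ?thesis by (meson rtrancl_trans)
  qed
  have connAB: "(y, z) \<in> F'\<^sup>*" if "y \<in> A \<union> B" "z \<in> A \<union> B" for y z
    using rtrancl_trans[OF symD[OF sym_rtrancl[OF symF'] toa[OF that(1)]] toa[OF that(2)]] .
  define C' where "C' = insert (A \<union> B) (C - {A, B})"
  have disj: "\<And>X Y. X \<in> C \<Longrightarrow> Y \<in> C \<Longrightarrow> X \<noteq> Y \<Longrightarrow> X \<inter> Y = {}"
    using C(1) by (auto simp: partition_on_def dest: disjointD)
  have notin: "A \<union> B \<notin> C - {A, B}"
    using disj[of "A \<union> B" A] AB a by auto
  have "partition_on K C'"
  proof (rule partition_onI)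
    show "\<Union>C' = K" using C(1) AB by (auto simp: C'_def partition_on_def)
    show "{} \<notin> C'" using C(1) a by (auto simp: C'_def partition_on_def)
    show "disjnt X Y" if XY: "X \<in> C'" "Y \<in> C'" "X \<noteq> Y" for X Y
    proof -
      have AB_disj: "disjnt Z (A \<union> B)" if "Z \<in> C - {A, B}" for Z
        using that disj[of Z A] disj[of Z B] AB by (simp add: disjnt_def Int_Un_distrib)
      consider "X \<in> C" "Y \<in> C" | "X = A \<union> B" "Y \<in> C - {A, B}" | "X \<in> C - {A, B}" "Y = A \<union> B"
        using XY unfolding C'_def by blast
      then show ?thesis
      proof cases
        case 1
        then show ?thesis using disj XY(3) by (simp add: disjnt_def)
      next
        case 2
        then show ?thesis using AB_disj[of Y] by (simp add: disjnt_sym)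
      next
        case 3
        then show ?thesis using AB_disj[of X] by simp
      qed
    qed
  qed
  moreover have "card C' = n"
  proof -
    have "card (C - {A, B}) = n - 1" using AB C(2) by (simp add: card_Diff_subset)
    then show ?thesis using notin finC step.prems by (simp add: C'_def)
  qed
  moreover have "F' \<subseteq> parcs G" using F Fa Fb by (auto simp: F'_def)
  moreover have "\<forall>X\<in>C'. \<forall>a\<in>X. \<forall>b\<in>X. (a, b) \<in> F'\<^sup>*"
  proof
    fix X assume "X \<in> C'"
    then consider "X = A \<union> B" | "X \<in> C" by (auto simp: C'_def)
    then show "\<forall>a\<in>X. \<forall>b\<in>X. (a, b) \<in> F'\<^sup>*"
    proof cases
      case 1
      then show ?thesis using connAB by simp
    next
      case 2
      show ?thesis by (intro ballI subsetD[OF mono(1)] conn[OF 2])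
    qed
  qed
  moreover have "real (card F') \<le> 4 * M * (harm (card K) - harm n)"
  proof -
    \<comment> \<open>Both paths have at most \<open>2 * r\<close> arcs, and
      \<open>4 * r \<le> 4 * M / (n + 1)\<close> is the amount by which the harmonic bound grows
      from \<open>Suc n\<close> to \<open>n\<close> clusters.\<close>
    have "card F' \<le> card F + card Fa + card Fb"
      unfolding F'_def by (meson add_le_mono1 card_Un_le le_trans)
    then have "real (card F') \<le> real (card F) + 4 * real r" using Fa Fb by simp
    also have "real r \<le> M / real (Suc n)" using rM by (simp add: field_simps)
    also have "real (card F) + 4 * (M / real (Suc n)) \<le> 4 * M * (harm (card K) - harm n)"
      using cF by (simp add: harm_Suc algebra_simps inverse_eq_divide)
    finally show ?thesis by simp
  qed
  ultimately show ?case by (intro exI[of _ C'] exI[of _ F'] conjI symF')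
qed

text \<open>Once a single cluster is left it is \<open>K\<close> itself, and the collected arcs
  connect it. Counting edges instead of arcs turns the factor 4 into 2.\<close>

lemma steiner_cost_le_log:
  fixes G :: "'v pair_pre_digraph" and M :: real
  assumes G: "pair_graph G" "Digraph_Component.connected (with_proj G)" and K: "K \<subseteq> pverts G" "K \<noteq> {}"
    and M: "\<And>C N. partition_on K C \<Longrightarrow> 2 \<le> card C \<Longrightarrow>
        (\<And>r A B. r < N \<Longrightarrow> A \<in> C \<Longrightarrow> B \<in> C \<Longrightarrow> A \<noteq> B \<Longrightarrow> nbhd G r A \<inter> nbhd G r B = {}) \<Longrightarrow>
        real N * real (card C) \<le> M"
    and "0 \<le> M"
  shows "real (steiner_cost G K) \<le> 2 * M * ln (card K)"
proof -
  interpret G: pair_graph G by fact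
  have "finite K" using K G.pair_finite_verts finite_subset by blast
  then have pos: "1 \<le> card K" using K by (simp add: Suc_le_eq card_gt_0_iff)
  have "\<exists>C F. partition_on K C \<and> card C = 1 \<and> F \<subseteq> parcs G \<and> sym F \<and>
     (\<forall>A\<in>C. \<forall>a\<in>A. \<forall>b\<in>A. (a, b) \<in> F\<^sup>*) \<and> real (card F) \<le> 4 * M * (harm (card K) - harm 1)"
    using G K(1) M order_refl pos by (rule kruskal_clusters)
  then obtain C F where C: "partition_on K C" "card C = 1" and F: "F \<subseteq> parcs G" "sym F"
    and conn: "\<forall>A\<in>C. \<forall>a\<in>A. \<forall>b\<in>A. (a, b) \<in> F\<^sup>*"
    and cF: "real (card F) \<le> 4 * M * (harm (card K) - harm 1)"
    by (elim exE conjE) (rule that)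
  have "C = {K}" using C by (auto simp: partition_on_def card_1_singleton_iff)
  obtain a where "a \<in> K" using K by blast
  have "steiner_cost G K \<le> card F div 2"
    using \<open>a \<in> K\<close> K conn \<open>C = {K}\<close> by (intro steiner_cost_le[OF G(1) F, of a]) auto
  then have "real (steiner_cost G K) \<le> card F / 2" by linarith
  also have "\<dots> \<le> 2 * M * (harm (card K) - 1)" using cF by (simp add: harm_def)
  also have "\<dots> \<le> 2 * M * ln (card K)"
  proof (rule mult_left_mono)
    \<comment> \<open>The sequence \<open>harm (m + 1) - ln (m + 1)\<close> decreases from its value
      1 at \<open>m = 0\<close>.\<close>
    obtain m where m: "card K = Suc m" using pos by (cases "card K") auto
    show "harm (card K) - 1 \<le> ln (real (card K))"
      using decseqD[OF decseq_harm_diff_ln, of 0 m] by (simp add: m harm_def)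
  qed (use \<open>0 \<le> M\<close> in simp)
  finally show ?thesis .
qed

section \<open>Simulation on the star\<close>

text \<open>A protocol may be specified by the messages \<open>M X t u v\<close> it sends on the input \<open>X\<close>, as long as
  indistinguishable inputs lead to the same behaviour: a node acts on any input compatible with its
  view.\<close>

definition ideal_view :: "'n pair_pre_digraph \<Rightarrow> ('n \<Rightarrow> 'k set) \<Rightarrow>
    (('k \<Rightarrow> 's) \<Rightarrow> nat \<Rightarrow> 'n \<Rightarrow> 'n \<Rightarrow> bool list) \<Rightarrow> ('k \<Rightarrow> 's) \<Rightarrow> nat \<Rightarrow> 'n \<Rightarrow> ('n, 'k, 's) view" where
  "ideal_view N I M X t v =
     (restrict X (I v), map (\<lambda>s u. if (u, v) \<in> parcs N then M X s u v else []) [0..<t])"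

lemma ideal_view_eq_iff:
  "ideal_view N I M X t v = ideal_view N I M Y t v \<longleftrightarrow>
     restrict X (I v) = restrict Y (I v) \<and> (\<forall>s<t. \<forall>u. (u, v) \<in> parcs N \<longrightarrow> M X s u v = M Y s u v)"
  by (auto simp: ideal_view_def fun_eq_iff)

text \<open>The three assumptions say that a view determines what its owner has to know: the
  messages it sends, the lengths of those it receives (which yields legality), and the answer at
  \<open>w\<close>.\<close>

lemma transcript_realizable:
  fixes M :: "('k \<Rightarrow> 's) \<Rightarrow> nat \<Rightarrow> 'n \<Rightarrow> 'n \<Rightarrow> bool list" and T :: nat
  assumes sender: "\<And>X Y t u v. X \<in> K \<rightarrow>\<^sub>E Sig \<Longrightarrow> Y \<in> K \<rightarrow>\<^sub>E Sig \<Longrightarrow> t < T \<Longrightarrow> (u, v) \<in> parcs N \<Longrightarrow>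
      ideal_view N I M X t u = ideal_view N I M Y t u \<Longrightarrow> M X t u v = M Y t u v"
    and receiver: "\<And>X Y t u v. X \<in> K \<rightarrow>\<^sub>E Sig \<Longrightarrow> Y \<in> K \<rightarrow>\<^sub>E Sig \<Longrightarrow> t < T \<Longrightarrow> (u, v) \<in> parcs N \<Longrightarrow>
      ideal_view N I M X t v = ideal_view N I M Y t v \<Longrightarrow> length (M X t u v) = length (M Y t u v)"
    and decides: "\<And>X Y. X \<in> K \<rightarrow>\<^sub>E Sig \<Longrightarrow> Y \<in> K \<rightarrow>\<^sub>E Sig \<Longrightarrow>
      ideal_view N I M X T w = ideal_view N I M Y T w \<Longrightarrow> ans X = ans Y"
  obtains \<pi> :: "('n, 'k, 's) protocol" where "rounds \<pi> = T" "legal N I K Sig \<pi>"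
    "\<And>X t u v. X \<in> K \<rightarrow>\<^sub>E Sig \<Longrightarrow> t < T \<Longrightarrow> (u, v) \<in> parcs N \<Longrightarrow>
       message \<pi> u v (view N I \<pi> X t u) = M X t u v"
    "\<And>X. X \<in> K \<rightarrow>\<^sub>E Sig \<Longrightarrow> answer \<pi> w (view N I \<pi> X T w) = ans X"
proof -
  \<comment> \<open>The round number is the length of the history, so a view alone suffices to pick
    a compatible input; by the assumptions the choice does not affect the behaviour.\<close>
  define inp where
    "inp u \<omega> = (SOME Y. Y \<in> K \<rightarrow>\<^sub>E Sig \<and> ideal_view N I M Y (length (snd \<omega>)) u = \<omega>)" for u \<omega>
  have inp: "inp u (ideal_view N I M X t u) \<in> K \<rightarrow>\<^sub>E Sig"
      "ideal_view N I M (inp u (ideal_view N I M X t u)) t u = ideal_view N I M X t u"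
    if "X \<in> K \<rightarrow>\<^sub>E Sig" for X t u
  proof -
    have len: "length (snd (ideal_view N I M X t u)) = t" by (simp add: ideal_view_def)
    have "inp u (ideal_view N I M X t u) \<in> K \<rightarrow>\<^sub>E Sig \<and>
      ideal_view N I M (inp u (ideal_view N I M X t u)) t u = ideal_view N I M X t u"
      unfolding inp_def len by (rule someI[of _ X]) (use that in simp)
    then show "inp u (ideal_view N I M X t u) \<in> K \<rightarrow>\<^sub>E Sig"
      "ideal_view N I M (inp u (ideal_view N I M X t u)) t u = ideal_view N I M X t u" by auto
  qed
  define \<pi> :: "('n, 'k, 's) protocol" where
    "\<pi> = \<lparr>rounds = T, message = (\<lambda>u v \<omega>. M (inp u \<omega>) (length (snd \<omega>)) u v),
      expects = (\<lambda>v u \<omega>. length (M (inp v \<omega>) (length (snd \<omega>)) u v)), answer = (\<lambda>v \<omega>. ans (inp v \<omega>))\<rparr>"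
  have len: "length (snd (ideal_view N I M X t u)) = t" for X t u by (simp add: ideal_view_def)
  have msg: "message \<pi> u v (ideal_view N I M X t u) = M X t u v"
    if "X \<in> K \<rightarrow>\<^sub>E Sig" "t < T" "(u, v) \<in> parcs N" for X t u v
    using sender[OF inp(1)[OF that(1)] that inp(2)[OF that(1)]] by (simp add: \<pi>_def len)
  have view: "view N I \<pi> X t v = ideal_view N I M X t v" if X: "X \<in> K \<rightarrow>\<^sub>E Sig" and "t \<le> T" for X t v
    using \<open>t \<le> T\<close>
  proof (induction t arbitrary: v)
    case 0
    then show ?case by (simp add: ideal_view_def)
  next
    case (Suc t)
    then have "view N I \<pi> X t u = ideal_view N I M X t u" for u by simp
    then show ?case using msg[OF X, of t] Suc.prems
      by (simp add: ideal_view_def[of N I M X "Suc t"] ideal_view_def[of N I M X t v] fun_eq_iff)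
  qed
  show ?thesis
  proof
    show "rounds \<pi> = T" by (simp add: \<pi>_def)
    show *: "message \<pi> u v (view N I \<pi> X t u) = M X t u v"
      if "X \<in> K \<rightarrow>\<^sub>E Sig" "t < T" "(u, v) \<in> parcs N" for X t u v
      using msg[OF that] view that by simp
    show "answer \<pi> w (view N I \<pi> X T w) = ans X" if "X \<in> K \<rightarrow>\<^sub>E Sig" for X
      using decides[OF inp(1)[OF that] that inp(2)[OF that]] view[OF that order_refl] by (simp add: \<pi>_def)
    show "legal N I K Sig \<pi>"
      unfolding legal_def
    proof (intro ballI allI impI, clarify)
      fix X t u v assume X: "X \<in> K \<rightarrow>\<^sub>E Sig" and t: "t < rounds \<pi>" and uv: "(u, v) \<in> parcs N"
      have t': "t < T" using t by (simp add: \<pi>_def)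
      have "expects \<pi> v u (view N I \<pi> X t v) = length (M X t u v)"
        using receiver[OF inp(1)[OF X] X t' uv inp(2)[OF X]] view[OF X, of t v] t' by (simp add: \<pi>_def len)
      then show "length (message \<pi> u v (view N I \<pi> X t u)) = expects \<pi> v u (view N I \<pi> X t v)"
        using *[OF X t' uv] by simp
    qed
  qed
qed

text \<open>Pieces of known lengths can be cut out of their concatenation. This is how a receiver
  unpacks bundled messages.\<close>

lemma concat_map_eqD:
  assumes "concat (map f xs) = concat (map g xs)" and "\<And>e. e \<in> set xs \<Longrightarrow> length (f e) = length (g e)"
    and "e \<in> set xs"
  shows "f e = g e"
  using assms by (induction xs) auto

lemma length_concat_map: "length (concat (map f xs)) = (\<Sum>e\<leftarrow>xs. length (f e))"
  by (simp add: length_concat comp_def)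

text \<open>Cut and paste: the executions on two inputs that agree on everything sent across a cut can
  be combined into an execution on a mixed input.\<close>

lemma view_mixed_input:
  assumes agree: "\<And>s u v. s < t \<Longrightarrow> (u, v) \<in> parcs N \<Longrightarrow> (u \<in> B) \<noteq> (v \<in> B) \<Longrightarrow>
      message \<pi> u v (view N I \<pi> X s u) = message \<pi> u v (view N I \<pi> Y s u)"
    and Z: "\<And>v. restrict Z (I v) = (if v \<in> B then restrict X (I v) else restrict Y (I v))"
  shows "view N I \<pi> Z t v = (if v \<in> B then view N I \<pi> X t v else view N I \<pi> Y t v)"
  using agree
proof (induction t arbitrary: v)
  case 0
  then show ?case by (simp add: Z)
next
  case (Suc t)
  have IH: "view N I \<pi> Z t u = (if u \<in> B then view N I \<pi> X t u else view N I \<pi> Y t u)" for u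
    using Suc.prems by (intro Suc.IH) simp
  have msg: "(if (u, v) \<in> parcs N then message \<pi> u v (view N I \<pi> Z t u) else []) =
     (if v \<in> B then if (u, v) \<in> parcs N then message \<pi> u v (view N I \<pi> X t u) else []
      else if (u, v) \<in> parcs N then message \<pi> u v (view N I \<pi> Y t u) else [])" for u
    using Suc.prems[of t u v] by (auto simp: IH)
  show ?case using IH[of v] by (simp add: msg Z)
qed


lemma sum_lessThan_double:
  fixes f :: "nat \<Rightarrow> 'a::comm_monoid_add"
  shows "(\<Sum>s<2 * n. f s) = (\<Sum>t<n. f (2 * t) + f (2 * t + 1))"
  by (induction n) (simp_all add: add.assoc)

text \<open>
  The node \<open>x\<close> of the star plays all nodes \<open>v\<close> with \<open>g v = x\<close>.  Round \<open>t\<close> becomes the two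
  rounds \<open>2 * t\<close>, in which the leaves send to the center everything that leaves their block, and
  \<open>2 * t + 1\<close>, in which the center delivers to every leaf what enters its block.
\<close>

locale star_simulation =
  fixes G :: "'v pair_pre_digraph" and K :: "'v set" and C :: "'v set set" and Sig :: "'s set"
    and \<pi> :: "('v, 'v, 's) protocol" and g :: "'v \<Rightarrow> 'v set option"
  assumes fin_arcs: "finite (parcs G)" and fin_C: "finite C" and cut: "multicut K C"
    and legal: "legal G (terminal_input K) K Sig \<pi>"
    and g_range: "\<And>v A. g v = Some A \<Longrightarrow> A \<in> C"
    and g_own: "\<And>v. v \<in> K \<Longrightarrow> v \<in> star_input K C (g v)"
begin

abbreviation V :: "('v \<Rightarrow> 's) \<Rightarrow> nat \<Rightarrow> 'v \<Rightarrow> ('v, 'v, 's) view" where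
  "V X t v \<equiv> view G (terminal_input K) \<pi> X t v"

definition msg :: "('v \<Rightarrow> 's) \<Rightarrow> nat \<Rightarrow> 'v \<times> 'v \<Rightarrow> bool list" where
  "msg X t e = message \<pi> (fst e) (snd e) (V X t (fst e))"

definition leaving :: "'v set \<Rightarrow> ('v \<times> 'v) set" where
  "leaving A = {e \<in> parcs G. g (fst e) = Some A \<and> g (snd e) \<noteq> Some A}"

definition entering :: "'v set \<Rightarrow> ('v \<times> 'v) set" where
  "entering A = {e \<in> parcs G. g (snd e) = Some A \<and> g (fst e) \<noteq> Some A}"

text \<open>A fixed order of the arcs, the same for sender and receiver, so that packets need no
  addresses.\<close>

definition enum :: "('v \<times> 'v) set \<Rightarrow> ('v \<times> 'v) list" where
  "enum S = (SOME xs. set xs = S \<and> distinct xs)"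

definition packet :: "('v \<Rightarrow> 's) \<Rightarrow> nat \<Rightarrow> ('v \<times> 'v) set \<Rightarrow> bool list" where
  "packet X t S = concat (map (msg X t) (enum S))"

definition star_msg :: "('v \<Rightarrow> 's) \<Rightarrow> nat \<Rightarrow> 'v set option \<Rightarrow> 'v set option \<Rightarrow> bool list" where
  "star_msg X s x y = (case (x, y) of
     (Some A, None) \<Rightarrow> if even s then packet X (s div 2) (leaving A) else []
   | (None, Some A) \<Rightarrow> if odd s then packet X (s div 2) (entering A) else []
   | _ \<Rightarrow> [])"

lemma enum: "S \<subseteq> parcs G \<Longrightarrow> set (enum S) = S \<and> distinct (enum S)"
  unfolding enum_def
  by (rule someI_ex) (use finite_distinct_list fin_arcs finite_subset in blast)

lemma leaving_subset: "leaving A \<subseteq> parcs G" and entering_subset: "entering A \<subseteq> parcs G"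
  by (auto simp: leaving_def entering_def)

lemma packet_cong: "S \<subseteq> parcs G \<Longrightarrow> (\<And>e. e \<in> S \<Longrightarrow> msg X t e = msg Y t e) \<Longrightarrow> packet X t S = packet Y t S"
  using enum[of S] by (auto simp: packet_def intro!: arg_cong[of _ _ concat])

lemma packet_eqD:
  assumes "S \<subseteq> parcs G" "packet X t S = packet Y t S"
    and "\<And>e. e \<in> S \<Longrightarrow> length (msg X t e) = length (msg Y t e)" and "e \<in> S"
  shows "msg X t e = msg Y t e"
  using concat_map_eqD[of "msg X t" "enum S" "msg Y t" e] assms enum[of S] by (auto simp: packet_def)

lemma length_packet: "S \<subseteq> parcs G \<Longrightarrow> length (packet X t S) = (\<Sum>e\<in>S. length (msg X t e))"
  using enum[of S] by (simp add: packet_def length_concat_map sum_list_distinct_conv_sum_set)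

lemma length_msg:
  assumes "X \<in> K \<rightarrow>\<^sub>E Sig" "t < rounds \<pi>" "e \<in> parcs G"
  shows "length (msg X t e) = expects \<pi> (snd e) (fst e) (V X t (snd e))"
  using legal assms unfolding legal_def msg_def by (cases e) fastforce

text \<open>By legality the length of an incoming message can be read off from the receiver's view,
  so a leaf can split a packet before knowing the messages in it.\<close>

lemma length_entering:
  assumes "X \<in> K \<rightarrow>\<^sub>E Sig" "Y \<in> K \<rightarrow>\<^sub>E Sig" "t < rounds \<pi>"
    and "\<And>v. g v = Some A \<Longrightarrow> V X t v = V Y t v" and "e \<in> entering A"
  shows "length (msg X t e) = length (msg Y t e)"
  using assms by (simp add: length_msg entering_def)

lemma restrict_terminal_input:
  fixes X Y :: "'v \<Rightarrow> 's"
  assumes "restrict X (star_input K C (g v)) = restrict Y (star_input K C (g v))"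
  shows "restrict X (terminal_input K v) = restrict Y (terminal_input K v)"
proof -
  have "terminal_input K v \<subseteq> star_input K C (g v)"
    using g_own by (auto simp: terminal_input_def)
  then have "restrict Z (terminal_input K v) =
      restrict (restrict Z (star_input K C (g v))) (terminal_input K v)" for Z :: "'v \<Rightarrow> 's"
    by (simp add: restrict_restrict inf.absorb2)
  then show ?thesis using assms by metis
qed

text \<open>A leaf can replay all nodes of its block: messages within the block follow from the
  views already reconstructed, the others are unpacked from what the center delivered.\<close>

lemma leaf_views:
  assumes XY: "X \<in> K \<rightarrow>\<^sub>E Sig" "Y \<in> K \<rightarrow>\<^sub>E Sig" and A: "restrict X A = restrict Y A"
    and "t \<le> rounds \<pi>" and "\<And>s. s < t \<Longrightarrow> packet X s (entering A) = packet Y s (entering A)"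
    and "g v = Some A"
  shows "V X t v = V Y t v"
  using assms(4-6)
proof (induction t arbitrary: v)
  case 0
  then show ?case using restrict_terminal_input[of X v Y] A by (simp add: star_input_def)
next
  case (Suc t)
  have IH: "V X t u = V Y t u" if "g u = Some A" for u
    using Suc.prems that by (intro Suc.IH) auto
  have "msg X t (u, v) = msg Y t (u, v)" if uv: "(u, v) \<in> parcs G" for u
  proof (cases "g u = Some A")
    case True
    then show ?thesis by (simp add: msg_def IH)
  next
    case False
    then have "(u, v) \<in> entering A" using uv Suc.prems by (simp add: entering_def)
    moreover have "length (msg X t e) = length (msg Y t e)" if "e \<in> entering A" for e
      using length_entering[OF XY _ IH that] Suc.prems by simp
    ultimately show ?thesis
      using Suc.prems by (intro packet_eqD[OF entering_subset, of X t A Y]) auto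
  qed
  moreover have "restrict X (terminal_input K v) = restrict Y (terminal_input K v)"
    using restrict_terminal_input[of X v Y] A Suc.prems by (simp add: star_input_def)
  ultimately show ?case using IH[of v] Suc.prems by (auto simp: msg_def)
qed

text \<open>The center has to know how long the messages it relays are.  Their lengths are determined by
  what has crossed the blocks so far, because sender and receiver can be given different inputs
  that are compatible with it, and still agree.\<close>

lemma length_leaving:
  assumes XY: "X \<in> K \<rightarrow>\<^sub>E Sig" "Y \<in> K \<rightarrow>\<^sub>E Sig" and t: "t < rounds \<pi>" and A: "A \<in> C"
    and agree: "\<And>s e. s < t \<Longrightarrow> e \<in> parcs G \<Longrightarrow> g (fst e) \<noteq> g (snd e) \<Longrightarrow> msg X s e = msg Y s e"
    and e: "e \<in> leaving A"
  shows "length (msg X t e) = length (msg Y t e)"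
proof -
  define Z where "Z k = (if k \<in> A then X k else Y k)" for k
  have AK: "A \<subseteq> K" using cut A by (simp add: multicut_def)
  have Z: "Z \<in> K \<rightarrow>\<^sub>E Sig"
    using XY AK by (auto simp: Z_def PiE_def Pi_def extensional_def)
  have mem: "v \<in> A \<longleftrightarrow> g v = Some A" if v: "v \<in> K" for v
  proof (cases "g v")
    case None
    then show ?thesis using g_own[OF v] A by (auto simp: star_input_def)
  next
    case (Some B)
    then have "v \<in> B" "B \<in> C" using g_own[OF v] g_range by (auto simp: star_input_def)
    then show ?thesis using A Some cut by (auto simp: multicut_def dest: disjointD)
  qed
  have "V Z t v = (if v \<in> {v. g v = Some A} then V X t v else V Y t v)" for v
  proof (rule view_mixed_input)
    show "message \<pi> u v (V X s u) = message \<pi> u v (V Y s u)"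
      if "s < t" "(u, v) \<in> parcs G" "(u \<in> {v. g v = Some A}) \<noteq> (v \<in> {v. g v = Some A})" for s u v
      using agree[OF that(1,2)] that(3) by (auto simp: msg_def)
    show "restrict Z (terminal_input K v) =
        (if v \<in> {v. g v = Some A} then restrict X (terminal_input K v) else restrict Y (terminal_input K v))" for v
      using mem[of v] by (auto simp: terminal_input_def Z_def restrict_def fun_eq_iff)
  qed
  note view_Z = this
  have e': "e \<in> parcs G" "g (fst e) = Some A" "g (snd e) \<noteq> Some A" using e by (auto simp: leaving_def)
  \<comment> \<open>On \<open>Z\<close> the sender inside the block has its view from
    \<open>X\<close> and the receiver outside has its view from \<open>Y\<close>; legality on
    \<open>Z\<close> equates the length with the one expected on \<open>Y\<close>.\<close>
  have "length (msg X t e) = length (msg Z t e)" using e' by (simp add: msg_def view_Z)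
  also have "\<dots> = expects \<pi> (snd e) (fst e) (V Y t (snd e))"
    using e' by (simp add: length_msg[OF Z t] view_Z)
  also have "\<dots> = length (msg Y t e)" using e' by (simp add: length_msg[OF XY(2) t])
  finally show ?thesis .
qed

text \<open>The two claims need each other: messages from the center's own nodes follow from their
  views, and unpacking those from the leaves in round \<open>t\<close> needs
  \<open>length_leaving\<close>, hence all earlier messages between different parts.\<close>

lemma center_views:
  assumes XY: "X \<in> K \<rightarrow>\<^sub>E Sig" "Y \<in> K \<rightarrow>\<^sub>E Sig" and R: "restrict X (K - \<Union>C) = restrict Y (K - \<Union>C)"
    and "t \<le> rounds \<pi>"
    and "\<And>s A. s < t \<Longrightarrow> A \<in> C \<Longrightarrow> packet X s (leaving A) = packet Y s (leaving A)"
  shows "(\<forall>s<t. \<forall>e\<in>parcs G. g (fst e) \<noteq> g (snd e) \<longrightarrow> msg X s e = msg Y s e) \<and>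
    (\<forall>v. g v = None \<longrightarrow> V X t v = V Y t v)"
  using assms(4,5)
proof (induction t)
  case 0
  have "restrict X (terminal_input K v) = restrict Y (terminal_input K v)" if "g v = None" for v
    using restrict_terminal_input[of X v Y] R that by (simp add: star_input_def)
  then show ?case by simp
next
  case (Suc t)
  have t: "t < rounds \<pi>" using Suc.prems by simp
  have IH: "(\<forall>s<t. \<forall>e\<in>parcs G. g (fst e) \<noteq> g (snd e) \<longrightarrow> msg X s e = msg Y s e) \<and>
    (\<forall>v. g v = None \<longrightarrow> V X t v = V Y t v)"
    using Suc.prems by (intro Suc.IH) auto
  have new: "msg X t e = msg Y t e" if e: "e \<in> parcs G" "g (fst e) \<noteq> g (snd e)" for e
  proof (cases "g (fst e)")
    case None
    then show ?thesis using IH by (simp add: msg_def)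
  next
    case (Some A)
    then have A: "A \<in> C" and eA: "e \<in> leaving A" using e g_range by (auto simp: leaving_def)
    show ?thesis
    proof (rule packet_eqD[OF leaving_subset _ _ eA])
      show "packet X t (leaving A) = packet Y t (leaving A)" using Suc.prems A by simp
      show "length (msg X t e') = length (msg Y t e')" if "e' \<in> leaving A" for e'
        using IH by (intro length_leaving[OF XY t A _ that]) simp
    qed
  qed
  have "V X (Suc t) v = V Y (Suc t) v" if v: "g v = None" for v
  proof -
    have "msg X t (u, v) = msg Y t (u, v)" if "(u, v) \<in> parcs G" for u
      using new[OF that] IH v by (cases "g u") (auto simp: msg_def)
    moreover have "restrict X (terminal_input K v) = restrict Y (terminal_input K v)"
      using restrict_terminal_input[of X v Y] R v by (simp add: star_input_def)
    ultimately show ?thesis using IH v by (auto simp: msg_def)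
  qed
  then show ?case using IH new by (auto simp: less_Suc_eq)
qed

text \<open>An arc between two parts is paid for once at each end that lies in a leaf; between two
  leaves it is relayed by the center and so counts twice.\<close>

lemma star_protocol:
  obtains \<pi>' :: "('v set option, 'v, 's) protocol" where "legal (star C) (star_input K C) K Sig \<pi>'"
    and "\<And>X. X \<in> K \<rightarrow>\<^sub>E Sig \<Longrightarrow> answer \<pi>' (g w) (view (star C) (star_input K C) \<pi>' X (rounds \<pi>') (g w)) =
        answer \<pi> w (V X (rounds \<pi>) w)"
    and "\<And>X. X \<in> K \<rightarrow>\<^sub>E Sig \<Longrightarrow> cost (star C) (star_input K C) \<pi>' X =
        (\<Sum>t<rounds \<pi>. \<Sum>A\<in>C. (\<Sum>e\<in>leaving A. length (msg X t e)) + (\<Sum>e\<in>entering A. length (msg X t e)))"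
proof -
  let ?view = "ideal_view (star C) (star_input K C) star_msg"
  let ?T = "2 * rounds \<pi>"
  have arcs: "(\<exists>A\<in>C. x = Some A \<and> y = None \<or> x = None \<and> y = Some A)" if "(x, y) \<in> parcs (star C)" for x y
    using that by (auto simp: star_def)
  \<comment> \<open>Before star round \<open>s\<close> a leaf has the deliveries of all rounds
    \<open>2 * r + 1\<close> below \<open>s\<close>; with \<open>2 * t \<le> s\<close> these cover
    all \<open>r < t\<close>.\<close>
  have leaf: "V X t v = V Y t v"
    if XY: "X \<in> K \<rightarrow>\<^sub>E Sig" "Y \<in> K \<rightarrow>\<^sub>E Sig" and eq: "?view X s (Some A) = ?view Y s (Some A)"
      and A: "A \<in> C" and t: "t \<le> rounds \<pi>" "2 * t \<le> s" and v: "g v = Some A" for X Y s A t v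
  proof (rule leaf_views[OF XY _ t(1) _ v])
    show "restrict X A = restrict Y A" using eq by (simp add: ideal_view_eq_iff star_input_def)
    show "packet X r (entering A) = packet Y r (entering A)" if "r < t" for r
    proof -
      have "star_msg X (2 * r + 1) None (Some A) = star_msg Y (2 * r + 1) None (Some A)"
        using eq A t that by (simp add: ideal_view_eq_iff star_def)
      then show ?thesis by (simp add: star_msg_def)
    qed
  qed
  \<comment> \<open>The center hears in round \<open>2 * r\<close>, one round before the leaves, so
    \<open>2 * t \<le> Suc s\<close> is enough to cover all \<open>r < t\<close>.\<close>
  have center: "(\<forall>s<t. \<forall>e\<in>parcs G. g (fst e) \<noteq> g (snd e) \<longrightarrow> msg X s e = msg Y s e) \<and>
    (\<forall>v. g v = None \<longrightarrow> V X t v = V Y t v)"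
    if XY: "X \<in> K \<rightarrow>\<^sub>E Sig" "Y \<in> K \<rightarrow>\<^sub>E Sig" and eq: "?view X s None = ?view Y s None"
      and t: "t \<le> rounds \<pi>" "2 * t \<le> Suc s" for X Y s t
  proof (rule center_views[OF XY _ t(1)])
    show "restrict X (K - \<Union>C) = restrict Y (K - \<Union>C)"
      using eq by (simp add: ideal_view_eq_iff star_input_def)
    show "packet X r (leaving A) = packet Y r (leaving A)" if "r < t" "A \<in> C" for r A
    proof -
      have "star_msg X (2 * r) (Some A) None = star_msg Y (2 * r) (Some A) None"
        using eq t that by (simp add: ideal_view_eq_iff star_def)
      then show ?thesis by (simp add: star_msg_def)
    qed
  qed
  obtain \<pi>' :: "('v set option, 'v, 's) protocol" where
    rounds: "rounds \<pi>' = ?T" and legal': "legal (star C) (star_input K C) K Sig \<pi>'"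
    and msg': "\<And>X t u v. X \<in> K \<rightarrow>\<^sub>E Sig \<Longrightarrow> t < ?T \<Longrightarrow> (u, v) \<in> parcs (star C) \<Longrightarrow>
       message \<pi>' u v (view (star C) (star_input K C) \<pi>' X t u) = star_msg X t u v"
    and ans': "\<And>X. X \<in> K \<rightarrow>\<^sub>E Sig \<Longrightarrow> answer \<pi>' (g w) (view (star C) (star_input K C) \<pi>' X ?T (g w)) =
        answer \<pi> w (V X (rounds \<pi>) w)"
  proof (rule transcript_realizable[where M = star_msg and T = ?T and K = K and Sig = Sig and
        N = "star C" and I = "star_input K C" and w = "g w" and ans = "\<lambda>X. answer \<pi> w (V X (rounds \<pi>) w)"])
    fix X Y s x y
    assume XY: "X \<in> K \<rightarrow>\<^sub>E Sig" "Y \<in> K \<rightarrow>\<^sub>E Sig" and s: "s < ?T" and xy: "(x, y) \<in> parcs (star C)"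
    define t where "t = s div 2"
    have t: "t < rounds \<pi>" "2 * t \<le> s" using s by (auto simp: t_def)
    from arcs[OF xy] obtain A where A: "A \<in> C" and "x = Some A \<and> y = None \<or> x = None \<and> y = Some A" by blast
    then consider (up) "x = Some A" "y = None" "even s" | (down) "x = None" "y = Some A" "odd s"
      | (idle) "star_msg X s x y = []" "star_msg Y s x y = []"
      by (cases "even s") (auto simp: star_msg_def)
    note cases = this
    show "star_msg X s x y = star_msg Y s x y" if eq: "?view X s x = ?view Y s x"
      using cases
    proof cases
      case up
      have "packet X t (leaving A) = packet Y t (leaving A)"
        using leaf[OF XY eq[unfolded up] A _ t(2)] t(1)
        by (intro packet_cong[OF leaving_subset]) (simp add: leaving_def msg_def)
      then show ?thesis using up by (simp add: star_msg_def t_def)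
    next
      case down
      \<comment> \<open>In the odd round \<open>2 * t + 1\<close> the center has already received
        the packets of round \<open>t\<close> itself, hence \<open>Suc t\<close>.\<close>
      have "2 * Suc t \<le> Suc s" using down by (auto simp: t_def elim!: oddE)
      then have "packet X t (entering A) = packet Y t (entering A)"
        using center[OF XY eq[unfolded down], of "Suc t"] t(1)
        by (intro packet_cong[OF entering_subset]) (auto simp: entering_def)
      then show ?thesis using down by (simp add: star_msg_def t_def)
    qed simp
    show "length (star_msg X s x y) = length (star_msg Y s x y)" if eq: "?view X s y = ?view Y s y"
      using cases
    proof cases
      case up
      \<comment> \<open>While receiving round \<open>t\<close> the center only knows the crossing
        messages of earlier rounds, so the lengths come from \<open>length_leaving\<close>.\<close>
      have "length (msg X t e) = length (msg Y t e)" if "e \<in> leaving A" for e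
        using center[OF XY eq[unfolded up], of t] t
        by (intro length_leaving[OF XY t(1) A _ that]) auto
      then show ?thesis using up by (simp add: star_msg_def t_def length_packet[OF leaving_subset])
    next
      case down
      have "length (msg X t e) = length (msg Y t e)" if "e \<in> entering A" for e
        using leaf[OF XY eq[unfolded down] A _ t(2)] t(1)
        by (intro length_entering[OF XY t(1) _ that]) simp
      then show ?thesis using down by (simp add: star_msg_def t_def length_packet[OF entering_subset])
    qed simp
  next
    fix X Y assume XY: "X \<in> K \<rightarrow>\<^sub>E Sig" "Y \<in> K \<rightarrow>\<^sub>E Sig" and eq: "?view X ?T (g w) = ?view Y ?T (g w)"
    have "V X (rounds \<pi>) w = V Y (rounds \<pi>) w"
    proof (cases "g w")
      case None
      then show ?thesis using center[OF XY eq[unfolded None], of "rounds \<pi>"] by simp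
    next
      case (Some A)
      then show ?thesis using leaf[OF XY eq[unfolded Some] g_range[OF Some]] by simp
    qed
    then show "answer \<pi> w (V X (rounds \<pi>) w) = answer \<pi> w (V Y (rounds \<pi>) w)" by simp
  qed (rule that; blast)
  show ?thesis
  proof
    show "legal (star C) (star_input K C) K Sig \<pi>'" by fact
    fix X assume X: "X \<in> K \<rightarrow>\<^sub>E Sig"
    show "answer \<pi>' (g w) (view (star C) (star_input K C) \<pi>' X (rounds \<pi>') (g w)) =
        answer \<pi> w (V X (rounds \<pi>) w)" using ans'[OF X] by (simp add: rounds)
    have "cost (star C) (star_input K C) \<pi>' X = (\<Sum>s<?T. \<Sum>(x, y)\<in>parcs (star C). length (star_msg X s x y))"
      unfolding cost_def rounds using msg'[OF X] by (intro sum.cong) auto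
    also have "\<dots> = (\<Sum>s<?T. \<Sum>A\<in>C. length (star_msg X s None (Some A)) + length (star_msg X s (Some A) None))"
    proof (rule sum.cong)
      fix s
      have "(\<Sum>(x, y)\<in>parcs (star C). length (star_msg X s x y)) =
        (\<Sum>(x, y)\<in>(\<lambda>A. (None, Some A)) ` C. length (star_msg X s x y)) +
        (\<Sum>(x, y)\<in>(\<lambda>A. (Some A, None)) ` C. length (star_msg X s x y))"
        using fin_C by (simp add: star_def) (rule sum.union_disjoint; auto)
      then show "(\<Sum>(x, y)\<in>parcs (star C). length (star_msg X s x y)) =
        (\<Sum>A\<in>C. length (star_msg X s None (Some A)) + length (star_msg X s (Some A) None))"
        by (simp add: sum.reindex inj_on_def sum.distrib)
    qed simp
    also have "\<dots> = (\<Sum>t<rounds \<pi>. \<Sum>A\<in>C. length (packet X t (leaving A)) + length (packet X t (entering A)))"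
      by (simp add: sum_lessThan_double star_msg_def sum.distrib)
    finally show "cost (star C) (star_input K C) \<pi>' X =
        (\<Sum>t<rounds \<pi>. \<Sum>A\<in>C. (\<Sum>e\<in>leaving A. length (msg X t e)) + (\<Sum>e\<in>entering A. length (msg X t e)))"
      by (simp add: length_packet[OF leaving_subset] length_packet[OF entering_subset])
  qed
qed

end

section \<open>Layers around the clusters\<close>

text \<open>The assignment of nodes to players at radius \<open>r\<close>. The description with
  \<open>THE\<close> is meaningful when the neighbourhoods are pairwise disjoint, as
  \<open>block_eq_Some_iff\<close> assumes.\<close>

definition block :: "'v pair_pre_digraph \<Rightarrow> 'v set set \<Rightarrow> nat \<Rightarrow> 'v \<Rightarrow> 'v set option" where
  "block G C r v =
     (if \<exists>A\<in>C. v \<in> nbhd G r A then Some (THE A. A \<in> C \<and> v \<in> nbhd G r A) else None)"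

lemma block_eq_Some_iff:
  assumes "\<And>A B. A \<in> C \<Longrightarrow> B \<in> C \<Longrightarrow> A \<noteq> B \<Longrightarrow> nbhd G r A \<inter> nbhd G r B = {}"
  shows "block G C r v = Some A \<longleftrightarrow> A \<in> C \<and> v \<in> nbhd G r A"
proof (cases "\<exists>A\<in>C. v \<in> nbhd G r A")
  case True
  then obtain B where B: "B \<in> C" "v \<in> nbhd G r B" by blast
  have uniq: "A' = B" if "A' \<in> C \<and> v \<in> nbhd G r A'" for A' using assms[of A' B] B that by blast
  have "(THE A. A \<in> C \<and> v \<in> nbhd G r A) = B"
    by (rule the_equality) (use B in simp, rule uniq)
  then have "block G C r v = Some B" using True by (simp add: block_def)
  then show ?thesis using uniq[of A] B by (metis option.inject)
next
  case False
  then show ?thesis by (auto simp: block_def)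
qed

definition boundary :: "'v pair_pre_digraph \<Rightarrow> nat \<Rightarrow> 'v set \<Rightarrow> ('v \<times> 'v) set" where
  "boundary G r A = {e \<in> parcs G. fst e \<in> nbhd G r A \<and> snd e \<notin> nbhd G r A}"

definition msg_length :: "'v pair_pre_digraph \<Rightarrow> 'v set \<Rightarrow> ('v, 'v, 's) protocol \<Rightarrow> ('v \<Rightarrow> 's) \<Rightarrow> nat \<Rightarrow>
    'v \<times> 'v \<Rightarrow> nat" where
  "msg_length G K \<pi> X t e =
     length (message \<pi> (fst e) (snd e) (view G (terminal_input K) \<pi> X t (fst e)))"

lemma cost_eq_msg_length:
  "cost G (terminal_input K) \<pi> X = (\<Sum>t<rounds \<pi>. \<Sum>e\<in>parcs G. msg_length G K \<pi> X t e)"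
  by (simp add: cost_def msg_length_def case_prod_unfold)

text \<open>This is the simulation with blocks of radius \<open>r\<close>. By symmetry of
  \<open>G\<close> the arcs entering a block are the reversals of those leaving it, so the cost is
  expressed by boundaries alone.\<close>

lemma layer_protocol:
  fixes \<pi> :: "('v, 'v, 's) protocol"
  assumes G: "pair_graph G" and K: "K \<subseteq> pverts G" and C: "partition_on K C"
    and sep: "\<And>A B. A \<in> C \<Longrightarrow> B \<in> C \<Longrightarrow> A \<noteq> B \<Longrightarrow> nbhd G r A \<inter> nbhd G r B = {}"
    and legal: "legal G (terminal_input K) K Sig \<pi>"
  shows "\<exists>\<pi>' :: ('v set option, 'v, 's) protocol. legal (star C) (star_input K C) K Sig \<pi>' \<and>
    (\<forall>X \<in> K \<rightarrow>\<^sub>E Sig.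
      answer \<pi>' (block G C r w) (view (star C) (star_input K C) \<pi>' X (rounds \<pi>') (block G C r w)) =
        answer \<pi> w (view G (terminal_input K) \<pi> X (rounds \<pi>) w) \<and>
      cost (star C) (star_input K C) \<pi>' X =
        (\<Sum>t<rounds \<pi>. \<Sum>A\<in>C. (\<Sum>e\<in>boundary G r A. msg_length G K \<pi> X t e) +
           (\<Sum>e\<in>prod.swap ` boundary G r A. msg_length G K \<pi> X t e)))"
proof -
  interpret G: pair_graph G by fact
  have UC: "\<Union>C = K" using C by (simp add: partition_on_def)
  have finC: "finite C"
    using C K G.pair_finite_verts finite_elements finite_subset by metis
  note iff = block_eq_Some_iff[OF sep]
  have K_block: "v \<in> star_input K C (block G C r v)" if v: "v \<in> K" for v
  proof -
    obtain A where A: "A \<in> C" "v \<in> A" using v UC by blast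
    then have "v \<in> nbhd G r A" using nbhd_mono[of 0 r G A] by auto
    then have "block G C r v = Some A" using A iff by simp
    then show ?thesis using A by (simp add: star_input_def)
  qed
  interpret S: star_simulation G K C Sig \<pi> "block G C r"
  proof
    show "multicut K C" using C by (auto simp: multicut_def partition_on_def)
  qed (use G.pair_finite_arcs finC legal iff K_block in auto)
  have leaving: "S.leaving A = boundary G r A" if "A \<in> C" for A
    using that iff by (auto simp: S.leaving_def boundary_def)
  have entering: "S.entering A = prod.swap ` boundary G r A" if "A \<in> C" for A
  proof -
    have "e \<in> S.entering A \<longleftrightarrow> prod.swap e \<in> boundary G r A" for e
      using that iff G.arcs_symmetric by (cases e) (auto simp: S.entering_def boundary_def)
    then show ?thesis by (force simp: image_iff)
  qed
  have len: "length (S.msg X t e) = msg_length G K \<pi> X t e" for X t e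
    by (simp add: S.msg_def msg_length_def)
  show ?thesis
    by (rule S.star_protocol[of w]) (auto simp: leaving entering len intro!: exI)
qed

text \<open>An arc leaving the neighbourhood of radius \<open>r\<close> ends in the one of radius \<open>r + 1\<close>, so it leaves
  no larger one.\<close>

lemma boundary_disjoint:
  assumes sep: "\<And>r A B. r < N \<Longrightarrow> A \<in> C \<Longrightarrow> B \<in> C \<Longrightarrow> A \<noteq> B \<Longrightarrow> nbhd G r A \<inter> nbhd G r B = {}"
    and "r < N" "s < N" "A \<in> C" "B \<in> C" and e: "e \<in> boundary G r A" "e \<in> boundary G s B"
  shows "r = s \<and> A = B"
proof -
  have eq: "A = B"
  proof (rule ccontr)
    assume "A \<noteq> B"
    moreover have "fst e \<in> nbhd G (max r s) A" "fst e \<in> nbhd G (max r s) B"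
      using e nbhd_mono[of r "max r s" G A] nbhd_mono[of s "max r s" G B] by (auto simp: boundary_def)
    ultimately show False using sep[of "max r s" A B] assms(2-5) by auto
  qed
  have step: "\<not> r < s" if "e \<in> boundary G r A" "e \<in> boundary G s A" for r s
  proof
    assume "r < s"
    have "snd e \<in> nbhd G (Suc r) A" using that(1) by (cases e) (auto simp: boundary_def)
    then have "snd e \<in> nbhd G s A" using nbhd_mono[of "Suc r" s G A] \<open>r < s\<close> by auto
    then show False using that(2) by (simp add: boundary_def)
  qed
  show ?thesis using e step[of r s] step[of s r] eq by auto
qed

lemma sum_boundary_le:
  fixes F :: "'v \<times> 'v \<Rightarrow> nat"
  assumes fin: "finite (parcs G)" "finite C"
    and sep: "\<And>r A B. r < N \<Longrightarrow> A \<in> C \<Longrightarrow> B \<in> C \<Longrightarrow> A \<noteq> B \<Longrightarrow> nbhd G r A \<inter> nbhd G r B = {}"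
  shows "(\<Sum>r<N. \<Sum>A\<in>C. \<Sum>e\<in>boundary G r A. F e) \<le> (\<Sum>e\<in>parcs G. F e)"
proof -
  have sub: "boundary G r A \<subseteq> parcs G" for r A by (auto simp: boundary_def)
  have "(\<Sum>r<N. \<Sum>A\<in>C. \<Sum>e\<in>boundary G r A. F e) = (\<Sum>p\<in>{..<N} \<times> C. \<Sum>e\<in>boundary G (fst p) (snd p). F e)"
    by (simp add: sum.cartesian_product case_prod_unfold)
  also have "\<dots> = (\<Sum>e\<in>(\<Union>p\<in>{..<N} \<times> C. boundary G (fst p) (snd p)). F e)"
  proof (rule sum.UNION_disjoint[symmetric])
    show "finite ({..<N} \<times> C)" using fin by simp
    show "\<forall>p\<in>{..<N} \<times> C. finite (boundary G (fst p) (snd p))"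
      using finite_subset[OF sub fin(1)] by blast
    show "\<forall>p\<in>{..<N} \<times> C. \<forall>q\<in>{..<N} \<times> C.
        p \<noteq> q \<longrightarrow> boundary G (fst p) (snd p) \<inter> boundary G (fst q) (snd q) = {}"
    proof (intro ballI impI, rule ccontr)
      fix p q assume pq: "p \<in> {..<N} \<times> C" "q \<in> {..<N} \<times> C" "p \<noteq> q"
        and "boundary G (fst p) (snd p) \<inter> boundary G (fst q) (snd q) \<noteq> {}"
      then obtain e where "e \<in> boundary G (fst p) (snd p)" "e \<in> boundary G (fst q) (snd q)" by blast
      then have "fst p = fst q \<and> snd p = snd q"
        using pq by (intro boundary_disjoint[where C = C and e = e, OF sep]) auto
      then show False using pq by (auto simp: prod_eq_iff)
    qed
  qed
  also have "\<dots> \<le> (\<Sum>e\<in>parcs G. F e)"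
    using sub fin by (intro sum_mono2) auto
  finally show ?thesis .
qed

text \<open>The factor 2 counts an arc once as leaving a block and once, through its reverse, as
  entering one.\<close>

lemma layers_cost_le:
  assumes G: "pair_graph G" and fin: "finite C"
    and sep: "\<And>r A B. r < N \<Longrightarrow> A \<in> C \<Longrightarrow> B \<in> C \<Longrightarrow> A \<noteq> B \<Longrightarrow> nbhd G r A \<inter> nbhd G r B = {}"
  shows "(\<Sum>r<N. \<Sum>t<rounds \<pi>. \<Sum>A\<in>C. (\<Sum>e\<in>boundary G r A. msg_length G K \<pi> X t e) +
      (\<Sum>e\<in>prod.swap ` boundary G r A. msg_length G K \<pi> X t e)) \<le> 2 * cost G (terminal_input K) \<pi> X"
proof -
  interpret G: pair_graph G by fact
  let ?m = "msg_length G K \<pi> X"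
  have swap: "prod.swap ` parcs G = parcs G"
    using G.arcs_symmetric by (force simp: image_iff)
  have "(\<Sum>r<N. \<Sum>t<rounds \<pi>. \<Sum>A\<in>C. (\<Sum>e\<in>boundary G r A. ?m t e) + (\<Sum>e\<in>prod.swap ` boundary G r A. ?m t e)) =
    (\<Sum>t<rounds \<pi>. (\<Sum>r<N. \<Sum>A\<in>C. \<Sum>e\<in>boundary G r A. ?m t e) +
      (\<Sum>r<N. \<Sum>A\<in>C. \<Sum>e\<in>boundary G r A. ?m t (prod.swap e)))"
    by (rule trans[OF sum.swap]) (simp add: sum.distrib sum.reindex)
  also have "\<dots> \<le> (\<Sum>t<rounds \<pi>. (\<Sum>e\<in>parcs G. ?m t e) + (\<Sum>e\<in>parcs G. ?m t (prod.swap e)))"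
    by (intro sum_mono add_mono sum_boundary_le G.pair_finite_arcs fin sep)
  also have "\<dots> = (\<Sum>t<rounds \<pi>. 2 * (\<Sum>e\<in>parcs G. ?m t e))"
  proof (rule sum.cong)
    fix t
    have "(\<Sum>e\<in>parcs G. ?m t (prod.swap e)) = (\<Sum>e\<in>prod.swap ` parcs G. ?m t e)"
      by (simp add: sum.reindex)
    then show "(\<Sum>e\<in>parcs G. ?m t e) + (\<Sum>e\<in>parcs G. ?m t (prod.swap e)) = 2 * (\<Sum>e\<in>parcs G. ?m t e)"
      by (simp add: swap)
  qed simp
  finally show ?thesis by (simp add: cost_eq_msg_length sum_distrib_left)
qed

section \<open>The lower bound for one partition and the final estimate\<close>

text \<open>The distribution \<open>\<mu>\<close> depends on \<open>C\<close> but not on the radius,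
  so the hardness bounds for the \<open>N\<close> radii add up under one expectation. On each input
  the summed costs are at most twice the cost on \<open>G\<close>, and the expectation is at most
  the supremum.\<close>

lemma layers_lower_bound:
  fixes P :: "('v, 'v, 's) protocol pmf"
  assumes G: "pair_graph G" and K: "K \<subseteq> pverts G" and hard: "maximally_hard c h K Sig f"
    and C: "partition_on K C" "2 \<le> card C"
    and sep: "\<And>r A B. r < N \<Longrightarrow> A \<in> C \<Longrightarrow> B \<in> C \<Longrightarrow> A \<noteq> B \<Longrightarrow> nbhd G r A \<inter> nbhd G r B = {}"
    and P: "computes G (terminal_input K) K Sig f w P"
  shows "of_nat N * ennreal (c * real (card C) * h (card Sig)) \<le>
    2 * (SUP X \<in> K \<rightarrow>\<^sub>E Sig. expected_cost G (terminal_input K) P X)"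
proof -
  interpret G: pair_graph G by fact
  have finC: "finite C" by (cases "finite C") (use C(2) in simp_all)
  let ?I = "star_input K C"
  let ?S = "SUP X \<in> K \<rightarrow>\<^sub>E Sig. expected_cost G (terminal_input K) P X"
  have "multicut K C" using C by (auto simp: multicut_def partition_on_def)
  \<comment> \<open>Two classes rule out the multicut exempted in
    \<open>maximally_hard\<close>.\<close>
  moreover have "C \<noteq> {K}" using C(2) by auto
  ultimately obtain \<mu> :: "('v \<Rightarrow> 's) pmf" where \<mu>: "set_pmf \<mu> \<subseteq> K \<rightarrow>\<^sub>E Sig"
    and hard_\<mu>: "\<And>w P. computes (star C) ?I K Sig f w P \<Longrightarrow>
       ennreal (c * real (card C) * h (card Sig)) \<le> (\<integral>\<^sup>+ X. expected_cost (star C) ?I P X \<partial>measure_pmf \<mu>)"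
    using hard unfolding maximally_hard_def by meson
  define sim_ok where "sim_ok r \<pi> \<pi>' \<longleftrightarrow> legal (star C) ?I K Sig \<pi>' \<and>
    (\<forall>X \<in> K \<rightarrow>\<^sub>E Sig.
      answer \<pi>' (block G C r w) (view (star C) ?I \<pi>' X (rounds \<pi>') (block G C r w)) =
        answer \<pi> w (view G (terminal_input K) \<pi> X (rounds \<pi>) w) \<and>
      cost (star C) ?I \<pi>' X =
        (\<Sum>t<rounds \<pi>. \<Sum>A\<in>C. (\<Sum>e\<in>boundary G r A. msg_length G K \<pi> X t e) +
           (\<Sum>e\<in>prod.swap ` boundary G r A. msg_length G K \<pi> X t e)))"
    for r and \<pi> :: "('v, 'v, 's) protocol" and \<pi>' :: "('v set option, 'v, 's) protocol"
  \<comment> \<open>The simulation is applied to each deterministic protocol separately, so the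
    image of \<open>P\<close> under \<open>sim r\<close> is a public-coin protocol on the
    star.\<close>
  define sim where "sim r \<pi> = (SOME \<pi>'. sim_ok r \<pi> \<pi>')" for r \<pi>
  have sim: "sim_ok r \<pi> (sim r \<pi>)" if "r < N" "\<pi> \<in> set_pmf P" for r \<pi>
  proof -
    have "legal G (terminal_input K) K Sig \<pi>" using P that by (simp add: computes_def)
    then have "\<exists>\<pi>'. sim_ok r \<pi> \<pi>'"
      unfolding sim_ok_def using that(1) by (intro layer_protocol G K C sep) auto
    then show ?thesis unfolding sim_def by (rule someI_ex)
  qed
  \<comment> \<open>The output node \<open>block G C r w\<close> does not depend on the coins, and
    on the support of \<open>P\<close> the simulated answers agree, so the success probability is
    kept.\<close>
  have comp: "computes (star C) ?I K Sig f (block G C r w) (map_pmf (sim r) P)" if r: "r < N" for r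
    unfolding computes_def
  proof (intro conjI ballI)
    show "block G C r w \<in> pverts (star C)"
    proof (cases "block G C r w")
      case (Some A)
      then have "A \<in> C" using block_eq_Some_iff[of C G r w A] sep[OF r] by blast
      then show ?thesis by (simp add: Some star_def)
    qed (simp add: star_def)
    show "legal (star C) ?I K Sig \<pi>'" if "\<pi>' \<in> set_pmf (map_pmf (sim r) P)" for \<pi>'
      using that sim[OF r] by (auto simp: sim_ok_def)
    fix X assume X: "X \<in> K \<rightarrow>\<^sub>E Sig"
    have "2 / 3 \<le> measure_pmf.prob P {\<pi>. answer \<pi> w (view G (terminal_input K) \<pi> X (rounds \<pi>) w) = f X}"
      using P X by (simp add: computes_def)
    also have "\<dots> \<le> measure_pmf.prob P (sim r -` {\<pi>'. answer \<pi>' (block G C r w)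
        (view (star C) ?I \<pi>' X (rounds \<pi>') (block G C r w)) = f X})"
      using sim[OF r] X
      by (intro measure_pmf.finite_measure_mono_AE) (auto simp: AE_measure_pmf_iff sim_ok_def)
    finally show "2 / 3 \<le> measure_pmf.prob (map_pmf (sim r) P) {\<pi>'. answer \<pi>' (block G C r w)
        (view (star C) ?I \<pi>' X (rounds \<pi>') (block G C r w)) = f X}"
      by (simp add: measure_map_pmf)
  qed
  have cost: "(\<Sum>r<N. expected_cost (star C) ?I (map_pmf (sim r) P) X) \<le> 2 * ?S"
    if X: "X \<in> K \<rightarrow>\<^sub>E Sig" for X
  proof -
    have "(\<Sum>r<N. expected_cost (star C) ?I (map_pmf (sim r) P) X) =
        (\<integral>\<^sup>+ \<pi>. of_nat (\<Sum>r<N. cost (star C) ?I (sim r \<pi>) X) \<partial>measure_pmf P)"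
      by (simp add: expected_cost_def nn_integral_sum)
    also have "\<dots> \<le> (\<integral>\<^sup>+ \<pi>. of_nat (2 * cost G (terminal_input K) \<pi> X) \<partial>measure_pmf P)"
    proof (rule nn_integral_mono_AE, unfold AE_measure_pmf_iff, intro ballI of_nat_mono)
      fix \<pi> assume \<pi>: "\<pi> \<in> set_pmf P"
      have "(\<Sum>r<N. cost (star C) ?I (sim r \<pi>) X) =
        (\<Sum>r<N. \<Sum>t<rounds \<pi>. \<Sum>A\<in>C. (\<Sum>e\<in>boundary G r A. msg_length G K \<pi> X t e) +
          (\<Sum>e\<in>prod.swap ` boundary G r A. msg_length G K \<pi> X t e))"
        using sim[OF _ \<pi>] X by (intro sum.cong) (auto simp: sim_ok_def)
      also have "\<dots> \<le> 2 * cost G (terminal_input K) \<pi> X" by (rule layers_cost_le[OF G finC sep])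
      finally show "(\<Sum>r<N. cost (star C) ?I (sim r \<pi>) X) \<le> 2 * cost G (terminal_input K) \<pi> X" .
    qed
    also have "\<dots> = 2 * expected_cost G (terminal_input K) P X"
      by (simp add: expected_cost_def nn_integral_cmult)
    also have "\<dots> \<le> 2 * ?S" by (intro mult_left_mono SUP_upper X) simp
    finally show ?thesis .
  qed
  have "of_nat N * ennreal (c * real (card C) * h (card Sig)) =
      (\<Sum>r<N. ennreal (c * real (card C) * h (card Sig)))" by simp
  also have "\<dots> \<le> (\<Sum>r<N. \<integral>\<^sup>+ X. expected_cost (star C) ?I (map_pmf (sim r) P) X \<partial>measure_pmf \<mu>)"
    using comp by (intro sum_mono hard_\<mu>) auto
  also have "\<dots> = (\<integral>\<^sup>+ X. (\<Sum>r<N. expected_cost (star C) ?I (map_pmf (sim r) P) X) \<partial>measure_pmf \<mu>)"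
    by (simp add: nn_integral_sum)
  also have "\<dots> \<le> (\<integral>\<^sup>+ X. 2 * ?S \<partial>measure_pmf \<mu>)"
    using cost \<mu> by (intro nn_integral_mono_AE) (auto simp: AE_measure_pmf_iff)
  also have "\<dots> = 2 * ?S" by (simp add: measure_pmf.emeasure_space_1)
  finally show ?thesis .
qed

theorem theorem3p3:
  fixes c :: real
  assumes "0 < c"
  shows "\<exists>c'>0. \<forall>(G :: 'v pair_pre_digraph) (K :: 'v set) (Sig :: 's set)
           (h :: nat \<Rightarrow> real) (f :: ('v \<Rightarrow> 's) \<Rightarrow> bool).
      pair_graph G \<longrightarrow> Digraph_Component.connected (with_proj G) \<longrightarrow> K \<subseteq> pverts G \<longrightarrow>
      finite Sig \<longrightarrow> (\<forall>n. 0 \<le> h n) \<longrightarrow> maximally_hard c h K Sig f \<longrightarrow>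
      ennreal (c' * (real (steiner_cost G K) * h (card Sig) / (log 2 (real (card K)))\<^sup>2))
        \<le> rand_cc f G K Sig"
proof (intro exI[of _ "c / 4"] conjI allI impI)
  \<comment> \<open>The 4 is the product of the factor 2 paid for the layers and the factor 2 in the
    bound on the Steiner tree.\<close>
  show "0 < c / 4" using assms by simp
  fix G :: "'v pair_pre_digraph" and K :: "'v set" and Sig :: "'s set"
    and h :: "nat \<Rightarrow> real" and f :: "('v \<Rightarrow> 's) \<Rightarrow> bool"
  assume G: "pair_graph G" "Digraph_Component.connected (with_proj G)" and K: "K \<subseteq> pverts G"
    and h: "\<forall>n. 0 \<le> h n" and hard: "maximally_hard c h K Sig f"
  let ?h = "h (card Sig)" and ?k = "real (card K)"
  show "ennreal (c / 4 * (real (steiner_cost G K) * ?h / (log 2 ?k)\<^sup>2)) \<le> rand_cc f G K Sig"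
    unfolding rand_cc_def
  proof (rule Inf_greatest, clarify)
    fix w P assume P: "computes G (terminal_input K) K Sig f w P"
    define S where "S = (SUP X \<in> K \<rightarrow>\<^sub>E Sig. expected_cost G (terminal_input K) P X)"
    have "ennreal (c / 4 * (real (steiner_cost G K) * ?h / (log 2 ?k)\<^sup>2)) \<le> S"
    proof (cases "?h = 0 \<or> card K \<le> 1 \<or> S = top")
      case True
      \<comment> \<open>Division by zero yields 0, and \<open>log 2 0 = 0\<close> covers empty
        \<open>K\<close>, so with at most one terminal the left side vanishes.\<close>
      have "log 2 ?k = 0" if "card K \<le> 1"
        using that by (cases "card K") (auto simp: log_def)
      then have "?h = 0 \<or> log 2 ?k = 0 \<or> S = top" using True by metis
      then show ?thesis by (elim disjE) simp_all
    next
      case False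
      then have h0: "0 < ?h" and k: "2 \<le> card K" and "S \<noteq> top"
        using h by (simp_all add: less_le)
      then obtain s where s: "S = ennreal s" "0 \<le> s" by (metis ennreal_cases)
      \<comment> \<open>This solves the bound of \<open>layers_lower_bound\<close> for
        \<open>N * card C\<close>.\<close>
      define M where "M = 2 * s / (c * ?h)"
      have M0: "0 \<le> M" using s h0 assms by (simp add: M_def)
      have "real (steiner_cost G K) \<le> 2 * M * ln ?k"
      proof (rule steiner_cost_le_log[OF G K _ _ M0])
        show "K \<noteq> {}" using k by auto
        fix C N assume C: "partition_on K C" "2 \<le> card C"
          and sep: "\<And>r A B. r < N \<Longrightarrow> A \<in> C \<Longrightarrow> B \<in> C \<Longrightarrow> A \<noteq> B \<Longrightarrow> nbhd G r A \<inter> nbhd G r B = {}"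
        have "of_nat N * ennreal (c * real (card C) * ?h) \<le> 2 * S"
          unfolding S_def by (rule layers_lower_bound[OF G(1) K hard C sep P])
        then have "ennreal (real N * (c * real (card C) * ?h)) \<le> ennreal (2 * s)"
          using s assms h0 by (simp add: ennreal_mult ennreal_of_nat_eq_real_of_nat)
        then have "real N * (c * real (card C) * ?h) \<le> 2 * s" using s by simp
        then show "real N * real (card C) \<le> M"
          using assms h0 by (simp add: M_def field_simps)
      qed
      then have "c / 4 * (real (steiner_cost G K) * ?h) \<le> c / 4 * (2 * M * ln ?k * ?h)"
        using assms h0 by (intro mult_left_mono mult_right_mono) auto
      also have "\<dots> = s * ln ?k" using assms h0 by (simp add: M_def field_simps)
      also have "\<dots> \<le> s * (log 2 ?k)\<^sup>2"
      proof (rule mult_left_mono[OF _ s(2)])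
        \<comment> \<open>For at least two terminals the binary logarithm is at least 1 and at least
          \<open>ln\<close>, so its square dominates the single logarithm of the tree bound.\<close>
        have "1 \<le> log 2 ?k" using k by simp
        have "ln ?k \<le> log 2 ?k" using k ln_2_less_1 by (simp add: log_def field_simps)
        also have "\<dots> \<le> (log 2 ?k)\<^sup>2" using \<open>1 \<le> log 2 ?k\<close> by (simp add: self_le_power)
        finally show "ln ?k \<le> (log 2 ?k)\<^sup>2" .
      qed
      finally have "c / 4 * (real (steiner_cost G K) * ?h / (log 2 ?k)\<^sup>2) \<le> s"
        using k s(2) by (simp add: divide_le_eq)
      then show ?thesis by (simp add: s ennreal_leI)
    qed
    then show "ennreal (c / 4 * (real (steiner_cost G K) * ?h / (log 2 ?k)\<^sup>2)) \<le>
        (SUP X \<in> K \<rightarrow>\<^sub>E Sig. expected_cost G (terminal_input K) P X)"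
      by (simp add: S_def)
  qed
qed

end
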